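(* Consider the problem $\phi^*:=\min_{x\in X}\{\phi(x):=f(x)+h(x)\}$, where $f$ is strongly convex with modulus $\mu>0$ and has Lipschitz constant $L$, and $h$ has Lipschitz constant $M$. Suppose that $M\ge L$ and that the prox-function $V$ grows quadratically, i.e. $V(x,u)\le\frac12\|x-u\|^2$ for all $x,u\in X$. If the parameters of the M-AGS algorithm are set to $$N_0=3\sqrt{\frac{2L}{\nu\mu}}\qquad\text{and}\qquad S=\log_2\max\left\{\frac{\Delta_0}{\varepsilon},1\right\},$$ then its output $v_S$ must be an $\varepsilon$-solution of $\min_{x\in X}\phi(x)$. Moreover, the total number of gradient evaluations of $\nabla f$ and $\nabla h$ performed by the M-AGS algorithm can be bounded by $$N_f:=3\sqrt{\frac{2L}{\nu\mu}}\log_2\max\left\{\frac{\Delta_0}{\varepsilon},1\right\}$$ and $$N_h:=(1+\ln 3)N_f\left(\sqrt{\frac{M}{L}}+1\right)<9\left(\sqrt{\frac{L}{\nu\mu}}+\sqrt{\frac{M}{\nu\mu}}\right)\log_2\max\left\{\frac{\Delta_0}{\varepsilon},1\right\},$$ respectively.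
   Context: Setting. $\|\cdot\|$ is a norm and $\langle\cdot,\cdot\rangle$ the inner product on $\mathbb{R}^n$; $X\subseteq\mathbb{R}^n$ is a closed convex set. $f,h:X\to\mathbb{R}$ are continuously differentiable convex functions and $L,M,\mu>0$ are such that, with $l_f(u,x):=f(u)+\langle\nabla f(u),x-u\rangle$ and $l_h(u,x):=h(u)+\langle\nabla h(u),x-u\rangle$, $$\tfrac{\mu}{2}\|x-u\|^2\le f(x)-l_f(u,x)\le\tfrac{L}{2}\|x-u\|^2,\qquad 0\le h(x)-l_h(u,x)\le\tfrac{M}{2}\|x-u\|^2,\qquad\forall x,u\in X.$$ For $\varepsilon>0$, an $\varepsilon$-solution of $\min_{x\in X}\phi(x)$ is a point $\bar x\in X$ with $\phi(\bar x)-\phi^*\le\varepsilon$. Prox-function. $V$ is a prox-function on $X$ with modulus $\nu>0$: there is a (differentiable) function $\pi$, strongly convex with parameter $\nu$ with respect to $\|\cdot\|$, such that $V(x,u)=\pi(u)-\pi(x)-\langle\nabla\pi(x),u-x\rangle$ for $x,u\in X$. Hence $V(x,u)\ge\frac{\nu}{2}\|x-u\|^2$. AGS (accelerated gradient sliding) algorithm. Choose $x_0\in X$ and set $\overline{x}_0=x_0$. For $k=1,\dots,N$: $$\underline{x}_k=(1-\gamma_k)\overline{x}_{k-1}+\gamma_kx_{k-1},\quad g_k(\cdot)=l_f(\underline{x}_k,\cdot),$$ $$(x_k,\tilde x_k)=\mathrm{ProxAG}(g_k,\overline{x}_{k-1},x_{k-1},\lambda_k,\beta_k,T_k),\quad \overline{x}_k=(1-\lambda_k)\overline{x}_{k-1}+\lambda_k\tilde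 x_k.$$ Output $\overline{x}_N$. Procedure $(x^+,\tilde x^+)=\mathrm{ProxAG}(g,\overline{x},x,\lambda,\beta,T)$: set $\tilde u_0=\overline{x}$, $u_0=x$. For $t=1,\dots,T$: $$\underline{u}_t=(1-\lambda)\overline{x}+\lambda(1-\alpha_t)\tilde u_{t-1}+\lambda\alpha_tu_{t-1},$$ $$u_t=\operatorname*{argmin}_{u\in X}\ g(u)+l_h(\underline{u}_t,u)+\beta V(x,u)+(\beta p_t+q_t)V(u_{t-1},u),$$ $$\tilde u_t=(1-\alpha_t)\tilde u_{t-1}+\alpha_tu_t.$$ Output $x^+=u_T$, $\tilde x^+=\tilde u_T$. AGS parameters used. In the first call to ProxAG ($k=1$): $\alpha_t=\frac{2}{t+1}$, $p_t=\frac{t-1}{2}$, $q_t=\frac{7LT_1(T_1+1)}{4\nu t}$. In the $k$-th call, $k>1$: $p_t\equiv p:=\sqrt{M/L}$, $\alpha_t\equiv\alpha:=\frac1{p+1}$, $q_t\equiv0$. Moreover $\gamma_k=\frac{2}{k+1}$; $T_1=\lceil\sqrt{8M/(7L)}\rceil$ and $T_k=\lceil\ln 3/(-\ln(1-\alpha))\rceil$ for $k>1$; $\lambda_1=1$ and $\lambda_k=\gamma_k/(1-(1-\alpha)^{T_k})$ for $k>1$; $\beta_1=L/\nu$ and $\beta_k=\frac{9L\gamma_k}{2\nu k\lambda_k}$ for $k>1$. M-AGS (multi-stage AGS) algorithm. Choose $v_0\in X$, accuracy $\varepsilon$, iteration limit $N_0$, and an initial estimate $\Delta_0$ such that $\phi(v_0)-\phi^*\le\Delta_0$.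 For $s=1,\dots,S$: run the AGS algorithm with $x_0=v_{s-1}$, $N=N_0$ and the AGS parameters above, and let $v_s=\overline{x}_N$ be its output. Output $v_S$. Counting. Each outer iteration of AGS uses one evaluation of $\nabla f$; each inner (ProxAG) iteration uses one evaluation of $\nabla h$ and none of $\nabla f$.
   Formalization: N_0 and S are rounded up to integers; the counts are then bounded with N_f replaced by N_0·S, and by N_f and N_h themselves when both given expressions are integers. The strict bound on N_h is claimed only for Δ_0>ε (both sides are 0 otherwise, and ≤ is stated). *)

theory Defs
  imports "HOL-Analysis.Analysis"
begin

definition norm_fun :: "('a::real_vector \<Rightarrow> real) \<Rightarrow> bool" where
  "norm_fun nrm \<longleftrightarrow>
     (\<forall>x. nrm x = 0 \<longleftrightarrow> x = 0) \<and>
     (\<forall>c x. nrm (c *\<^sub>R x) = \<bar>c\<bar> * nrm x) \<and>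
     (\<forall>x y. nrm (x + y) \<le> nrm x + nrm y)"

text \<open>
  The gradient is an explicit map because \<open>X\<close> may have boundary points, or even empty
  interior, in which case the derivative within \<open>X\<close> need not determine it.
\<close>

definition gradient_on :: "('a::euclidean_space) set \<Rightarrow> ('a \<Rightarrow> real) \<Rightarrow> ('a \<Rightarrow> 'a) \<Rightarrow> bool" where
  "gradient_on X f gf \<longleftrightarrow> (\<forall>x\<in>X. (f has_derivative (\<lambda>d. gf x \<bullet> d)) (at x within X))"

definition linearization :: "('a::euclidean_space \<Rightarrow> real) \<Rightarrow> ('a \<Rightarrow> 'a) \<Rightarrow> 'a \<Rightarrow> 'a \<Rightarrow> real" where
  "linearization f gf u x = f u + gf u \<bullet> (x - u)"

definition strongly_convex_on ::
  "('a::real_vector \<Rightarrow> real) \<Rightarrow> 'a set \<Rightarrow> real \<Rightarrow> ('a \<Rightarrow> real) \<Rightarrow> bool" where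
  "strongly_convex_on nrm X \<nu> \<pi> \<longleftrightarrow> convex X \<and>
     (\<forall>x\<in>X. \<forall>y\<in>X. \<forall>t\<in>{0..1}.
        \<pi> ((1 - t) *\<^sub>R x + t *\<^sub>R y)
          \<le> (1 - t) * \<pi> x + t * \<pi> y - \<nu> / 2 * t * (1 - t) * (nrm (x - y))\<^sup>2)"

definition prox_function ::
  "('a::euclidean_space \<Rightarrow> real) \<Rightarrow> 'a set \<Rightarrow> real \<Rightarrow> ('a \<Rightarrow> 'a \<Rightarrow> real) \<Rightarrow> bool" where
  "prox_function nrm X \<nu> V \<longleftrightarrow>
     (\<exists>\<pi> g\<pi>. strongly_convex_on nrm X \<nu> \<pi> \<and> gradient_on X \<pi> g\<pi> \<and>
        (\<forall>x\<in>X. \<forall>u\<in>X. V x u = \<pi> u - \<pi> x - g\<pi> x \<bullet> (u - x)))"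

text \<open>The real-valued infimum is the optimal value only if \<open>\<phi>\<close> is bounded below on \<open>X\<close>.\<close>

definition eps_solution :: "('a \<Rightarrow> real) \<Rightarrow> 'a set \<Rightarrow> real \<Rightarrow> 'a \<Rightarrow> bool" where
  "eps_solution \<phi> X \<epsilon> x \<longleftrightarrow> x \<in> X \<and> \<phi> x - (INF y\<in>X. \<phi> y) \<le> \<epsilon>"

text \<open>
  The state of the inner loop after \<open>t\<close> steps is \<open>(u, ut, n)\<close>, where \<open>n\<close> counts the
  evaluations of the gradient \<open>gh\<close>. Step \<open>Suc t\<close> uses the parameters with index \<open>Suc t\<close>.
\<close>

primrec prox_ag ::
  "'a::euclidean_space set \<Rightarrow> ('a \<Rightarrow> real) \<Rightarrow> ('a \<Rightarrow> 'a) \<Rightarrow> ('a \<Rightarrow> 'a \<Rightarrow> real)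
   \<Rightarrow> (nat \<Rightarrow> real) \<Rightarrow> (nat \<Rightarrow> real) \<Rightarrow> (nat \<Rightarrow> real)
   \<Rightarrow> ('a \<Rightarrow> real) \<Rightarrow> 'a \<Rightarrow> 'a \<Rightarrow> real \<Rightarrow> real \<Rightarrow> nat \<Rightarrow> 'a \<times> 'a \<times> nat" where
  "prox_ag X h gh V \<alpha> p q g xbar x ll \<beta> 0 = (x, xbar, 0)"
| "prox_ag X h gh V \<alpha> p q g xbar x ll \<beta> (Suc t) =
     (let (u, ut, n) = prox_ag X h gh V \<alpha> p q g xbar x ll \<beta> t;
          a = \<alpha> (Suc t);
          ul = (1 - ll) *\<^sub>R xbar + (ll * (1 - a)) *\<^sub>R ut + (ll * a) *\<^sub>R u;
          u' = (ARG_MIN (\<lambda>w. g w + linearization h gh ul w + \<beta> * V x w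
                              + (\<beta> * p (Suc t) + q (Suc t)) * V u w) w. w \<in> X)
      in (u', (1 - a) *\<^sub>R ut + a *\<^sub>R u', Suc n))"

text \<open>The field \<open>steps k\<close> is the number of steps \<open>T\<^sub>k\<close> of the \<open>k\<close>-th inner loop.\<close>

record ags_params =
  gam :: "nat \<Rightarrow> real"
  lam :: "nat \<Rightarrow> real"
  bet :: "nat \<Rightarrow> real"
  steps :: "nat \<Rightarrow> nat"
  alph :: "nat \<Rightarrow> nat \<Rightarrow> real"
  pp :: "nat \<Rightarrow> nat \<Rightarrow> real"
  qq :: "nat \<Rightarrow> nat \<Rightarrow> real"

text \<open>
  The state after \<open>k\<close> outer steps is \<open>(x\<^sub>k, xbar\<^sub>k, nf, nh)\<close>, where \<open>nf\<close> and \<open>nh\<close> count the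
  evaluations of \<open>gf\<close> and \<open>gh\<close>. The map \<open>g\<close> passed to the inner loop is affine and costs a
  single evaluation of \<open>gf\<close>, at \<open>xl\<close>.
\<close>

primrec ags ::
  "'a::euclidean_space set \<Rightarrow> ('a \<Rightarrow> real) \<Rightarrow> ('a \<Rightarrow> 'a) \<Rightarrow> ('a \<Rightarrow> real) \<Rightarrow> ('a \<Rightarrow> 'a)
   \<Rightarrow> ('a \<Rightarrow> 'a \<Rightarrow> real) \<Rightarrow> ags_params \<Rightarrow> 'a \<Rightarrow> nat \<Rightarrow> 'a \<times> 'a \<times> nat \<times> nat" where
  "ags X f gf h gh V P x0 0 = (x0, x0, 0, 0)"
| "ags X f gf h gh V P x0 (Suc k) =
     (let (x, xbar, nf, nh) = ags X f gf h gh V P x0 k;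
          j = Suc k;
          xl = (1 - gam P j) *\<^sub>R xbar + gam P j *\<^sub>R x;
          g = linearization f gf xl;
          (x', xt, n) = prox_ag X h gh V (alph P j) (pp P j) (qq P j)
                          g xbar x (lam P j) (bet P j) (steps P j)
      in (x', (1 - lam P j) *\<^sub>R xbar + lam P j *\<^sub>R xt, Suc nf, nh + n))"

text \<open>The state is \<open>(v\<^sub>s, nf, nh)\<close>, with total evaluation counts over all stages so far.\<close>

primrec mags ::
  "'a::euclidean_space set \<Rightarrow> ('a \<Rightarrow> real) \<Rightarrow> ('a \<Rightarrow> 'a) \<Rightarrow> ('a \<Rightarrow> real) \<Rightarrow> ('a \<Rightarrow> 'a)
   \<Rightarrow> ('a \<Rightarrow> 'a \<Rightarrow> real) \<Rightarrow> ags_params \<Rightarrow> 'a \<Rightarrow> nat \<Rightarrow> nat \<Rightarrow> 'a \<times> nat \<times> nat" where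
  "mags X f gf h gh V P v0 N 0 = (v0, 0, 0)"
| "mags X f gf h gh V P v0 N (Suc s) =
     (let (v, nf, nh) = mags X f gf h gh V P v0 N s;
          (_, xbar, mf, mh) = ags X f gf h gh V P v N
      in (xbar, nf + mf, nh + mh))"

definition ags_alpha :: "real \<Rightarrow> real \<Rightarrow> nat \<Rightarrow> nat \<Rightarrow> real" where
  "ags_alpha L M k t = (if k = 1 then 2 / (real t + 1) else 1 / (sqrt (M / L) + 1))"

definition ags_steps :: "real \<Rightarrow> real \<Rightarrow> nat \<Rightarrow> nat" where
  "ags_steps L M k =
     (if k = 1 then nat \<lceil>sqrt (8 * M / (7 * L))\<rceil>
      else nat \<lceil>ln 3 / (- ln (1 - 1 / (sqrt (M / L) + 1)))\<rceil>)"

definition ags_p :: "real \<Rightarrow> real \<Rightarrow> nat \<Rightarrow> nat \<Rightarrow> real" where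
  "ags_p L M k t = (if k = 1 then (real t - 1) / 2 else sqrt (M / L))"

definition ags_q :: "real \<Rightarrow> real \<Rightarrow> real \<Rightarrow> nat \<Rightarrow> nat \<Rightarrow> real" where
  "ags_q L M \<nu> k t =
     (if k = 1
      then 7 * L * real (ags_steps L M 1) * (real (ags_steps L M 1) + 1) / (4 * \<nu> * real t)
      else 0)"

definition ags_gamma :: "nat \<Rightarrow> real" where
  "ags_gamma k = 2 / (real k + 1)"

definition ags_lambda :: "real \<Rightarrow> real \<Rightarrow> nat \<Rightarrow> real" where
  "ags_lambda L M k =
     (if k = 1 then 1
      else ags_gamma k / (1 - (1 - 1 / (sqrt (M / L) + 1)) ^ ags_steps L M k))"

definition ags_beta :: "real \<Rightarrow> real \<Rightarrow> real \<Rightarrow> nat \<Rightarrow> real" where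
  "ags_beta L M \<nu> k =
     (if k = 1 then L / \<nu>
      else 9 * L * ags_gamma k / (2 * \<nu> * real k * ags_lambda L M k))"

definition ags_parameters :: "real \<Rightarrow> real \<Rightarrow> real \<Rightarrow> ags_params" where
  "ags_parameters L M \<nu> =
     \<lparr>gam = ags_gamma, lam = ags_lambda L M, bet = ags_beta L M \<nu>, steps = ags_steps L M,
      alph = ags_alpha L M, pp = ags_p L M, qq = ags_q L M \<nu>\<rparr>"

end

theory Submission
  imports Defs
begin

text \<open>
  Fix a comparison point \<open>u\<close> and write \<open>G = g + h\<close> for the objective seen by an inner loop.
  Three-point optimality of the prox step bounds the gap of \<open>G\<close> along the inner loop by a
  recursion, which telescopes after multiplication by weights \<open>\<theta> t\<close> with
  \<open>\<theta> t (1 - \<alpha>\<^sub>t) = \<theta> (t - 1)\<close>. The discarded terms \<open>- \<beta> V(x, u\<^sub>t)\<close> absorb the quadratic error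
  of linearizing \<open>f\<close>. The parameters make the outer recursion telescope too, so that
  \<open>k (k + 1) / 2\<close> times the gap after \<open>k\<close> outer steps is at most
  \<open>9 L / (2 \<nu>) (V(x\<^sub>0, u) - V(x\<^sub>k, u))\<close>. For \<open>u\<close> the minimizer, quadratic growth of \<open>V\<close> and
  strong convexity of \<open>f\<close> bound \<open>V(x\<^sub>0, u)\<close> by the initial gap divided by \<open>\<mu>\<close>, hence each stage
  halves the gap.
\<close>

section \<open>Norm comparison, existence of minimizers and first-order conditions\<close>

text \<open>Compactness of the Euclidean unit sphere gives the constant. It lets growth measured in
  \<open>nrm\<close> confine minimizers to Euclidean balls.\<close>

lemma norm_fun_lower_bound:
  fixes nrm :: "'a::euclidean_space \<Rightarrow> real"
  assumes "norm_fun nrm"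
  obtains k where "k > 0" "\<And>x. k * norm x \<le> nrm x"
proof (cases "sphere (0::'a) 1 = {}")
  case True
  have "x = 0" for x :: 'a
  proof (rule ccontr)
    assume "x \<noteq> 0"
    then have "x /\<^sub>R norm x \<in> sphere 0 1" by simp
    with True show False by blast
  qed
  then have "1 * norm x \<le> nrm x" for x :: 'a
    using assms unfolding norm_fun_def by (metis norm_zero mult_zero_right order_refl)
  then show ?thesis using that[of 1] by simp
next
  case False
  have n: "nrm x = 0 \<longleftrightarrow> x = 0" "nrm (c *\<^sub>R x) = \<bar>c\<bar> * nrm x" "nrm (x + y) \<le> nrm x + nrm y" for c x y
    using assms unfolding norm_fun_def by blast+
  \<comment> \<open>Convexity on an open set in finite dimension yields the continuity that the
    compactness argument requires.\<close>
  have "convex_on UNIV nrm"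
  proof (rule convex_onI)
    fix t :: real and x y :: 'a
    assume "0 < t" "t < 1"
    then show "nrm ((1 - t) *\<^sub>R x + t *\<^sub>R y) \<le> (1 - t) * nrm x + t * nrm y"
      using n(3)[of "(1 - t) *\<^sub>R x" "t *\<^sub>R y"] by (simp add: n(2))
  qed auto
  then have "continuous_on UNIV nrm" by (rule convex_on_continuous[OF open_UNIV])
  then have "continuous_on (sphere 0 1) nrm" by (rule continuous_on_subset) simp
  with False obtain z where z: "z \<in> sphere 0 1" "\<And>y. y \<in> sphere 0 1 \<Longrightarrow> nrm z \<le> nrm y"
    by (metis continuous_attains_inf[OF compact_sphere])
  have nn: "0 \<le> nrm x" for x
    using n(3)[of x "- x"] n(2)[of "-1" x] n(1)[of 0] by simp
  have "nrm z \<noteq> 0" using z(1) n(1)[of z] by auto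
  with nn[of z] have "nrm z > 0" by simp
  moreover have "nrm z * norm x \<le> nrm x" for x
  proof (cases "x = 0")
    case False
    then have "nrm z \<le> nrm (inverse (norm x) *\<^sub>R x)" by (intro z(2)) simp
    with False show ?thesis by (simp add: n(2) field_simps)
  qed (use n(1)[of 0] in simp)
  ultimately show ?thesis using that by blast
qed

text \<open>Far from \<open>x\<close> the quadratic term beats the linear one, which leaves a
  compact piece of \<open>X\<close> to search. This supplies minimizers both for the prox steps and
  for the whole objective.\<close>

lemma quadratic_growth_attains_min:
  fixes F :: "'a::euclidean_space \<Rightarrow> real"
  assumes "norm_fun nrm" "closed X" "x \<in> X" "continuous_on X F" "c > 0"
    and low: "\<And>y. y \<in> X \<Longrightarrow> F x + a \<bullet> (y - x) + c * (nrm (y - x))\<^sup>2 \<le> F y"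
  obtains m where "m \<in> X" "\<And>y. y \<in> X \<Longrightarrow> F m \<le> F y"
proof -
  obtain k where k: "k > 0" "\<And>x. k * norm x \<le> nrm x"
    using norm_fun_lower_bound[OF assms(1)] by blast
  \<comment> \<open>Beyond distance \<open>r\<close> the growth
    \<open>c * k\<^sup>2 * d\<^sup>2\<close> is at least the possible loss
    \<open>norm a * d\<close>.\<close>
  define r where "r = norm a / (c * k\<^sup>2)"
  have "r \<ge> 0" using k(1) assms(5) by (simp add: r_def)
  have "compact (X \<inter> cball x r)" using assms(2) by (simp add: closed_Int_compact)
  moreover have "x \<in> X \<inter> cball x r" using assms(3) \<open>r \<ge> 0\<close> by simp
  moreover have "continuous_on (X \<inter> cball x r) F"
    using assms(4) by (rule continuous_on_subset) simp
  ultimately obtain m where m: "m \<in> X \<inter> cball x r" "\<And>y. y \<in> X \<inter> cball x r \<Longrightarrow> F m \<le> F y"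
    using continuous_attains_inf[of "X \<inter> cball x r" F] by blast
  have "F m \<le> F y" if "y \<in> X" for y
  proof (cases "y \<in> cball x r")
    case False
    define d where "d = norm (y - x)"
    have d: "r \<le> d" "0 \<le> d" using False by (auto simp: d_def dist_norm norm_minus_commute)
    have "norm a \<le> c * k\<^sup>2 * d"
      using d(1) k(1) assms(5) by (simp add: r_def field_simps)
    then have "norm a * d \<le> c * (k * d)\<^sup>2"
      using mult_right_mono[OF _ d(2)] by (fastforce simp: power2_eq_square algebra_simps)
    also have "\<dots> \<le> c * (nrm (y - x))\<^sup>2"
      using k d(2) assms(5) by (intro mult_left_mono power_mono) (auto simp: d_def)
    finally have "norm a * d \<le> c * (nrm (y - x))\<^sup>2" .
    moreover have "- (norm a * d) \<le> a \<bullet> (y - x)"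
      using Cauchy_Schwarz_ineq2[of a "y - x"] by (simp add: d_def abs_le_iff)
    ultimately have "F x \<le> F y" using low[OF that] by simp
    then show ?thesis using m(2)[of x] assms(3) \<open>r \<ge> 0\<close> by force
  qed (use m(2) that in simp)
  with m(1) that show ?thesis by blast
qed

text \<open>Differentiability within \<open>X\<close> becomes a one-sided derivative in one real
  variable, which makes sense even where \<open>X\<close> has no interior.\<close>

lemma gradient_along_segment:
  assumes "gradient_on X F gF" "convex X" "x \<in> X" "y \<in> X"
  shows "((\<lambda>t. F (x + t *\<^sub>R (y - x))) has_real_derivative gF x \<bullet> (y - x)) (at 0 within {0..1})"
proof -
  have sub: "(\<lambda>t. x + t *\<^sub>R (y - x)) ` {0..1} \<subseteq> X"
  proof (clarsimp)
    fix t :: real assume "0 \<le> t" "t \<le> 1"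
    with convexD_alt[OF assms(2-4)] show "x + t *\<^sub>R (y - x) \<in> X"
      by (simp add: algebra_simps)
  qed
  have "(F has_derivative (\<lambda>d. gF x \<bullet> d)) (at x within X)"
    using assms unfolding gradient_on_def by blast
  then have "(F has_derivative (\<lambda>d. gF x \<bullet> d))
      (at (x + 0 *\<^sub>R (y - x)) within (\<lambda>t. x + t *\<^sub>R (y - x)) ` {0..1})"
    using sub by (auto intro: has_derivative_subset)
  moreover have "((\<lambda>t. x + t *\<^sub>R (y - x)) has_derivative (\<lambda>t. t *\<^sub>R (y - x))) (at 0 within {0..1})"
    by (auto intro!: derivative_eq_intros)
  ultimately have "(F \<circ> (\<lambda>t. x + t *\<^sub>R (y - x)) has_derivative
      (\<lambda>d. gF x \<bullet> d) \<circ> (\<lambda>t. t *\<^sub>R (y - x))) (at 0 within {0..1})"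
    by (intro diff_chain_within) auto
  then show ?thesis
    by (simp add: has_field_derivative_def o_def mult.commute[of "gF x \<bullet> (y - x)"] mult_commute_abs)
qed

lemma min_at_left_endpoint_deriv_nonneg:
  fixes \<psi> :: "real \<Rightarrow> real"
  assumes "(\<psi> has_real_derivative D) (at 0 within {0..1})"
    and "\<And>t. 0 \<le> t \<Longrightarrow> t \<le> 1 \<Longrightarrow> \<psi> 0 \<le> \<psi> t"
  shows "0 \<le> D"
proof (rule ccontr)
  assume "\<not> 0 \<le> D"
  then obtain d where d: "d > 0" "\<And>h. h > 0 \<Longrightarrow> h \<in> {0..1} \<Longrightarrow> h < d \<Longrightarrow> \<psi> h < \<psi> 0"
    using has_real_derivative_neg_dec_right[OF assms(1)] by force
  define t where "t = min 1 (d / 2)"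
  have "\<psi> t < \<psi> 0" using d by (intro d(2)) (auto simp: t_def)
  with assms(2)[of t] d(1) show False by (simp add: t_def)
qed

lemma first_order_optimality:
  assumes "gradient_on X F gF" "convex X" "z \<in> X" "u \<in> X" "\<And>y. y \<in> X \<Longrightarrow> F z \<le> F y"
  shows "0 \<le> gF z \<bullet> (u - z)"
proof (rule min_at_left_endpoint_deriv_nonneg[OF gradient_along_segment[OF assms(1-4)]])
  fix t :: real assume "0 \<le> t" "t \<le> 1"
  with convexD_alt[OF assms(2-4)] have "z + t *\<^sub>R (u - z) \<in> X"
    by (simp add: algebra_simps)
  with assms(5) show "F (z + 0 *\<^sub>R (u - z)) \<le> F (z + t *\<^sub>R (u - z))" by simp
qed

lemma strongly_convex_on_gradient_ineq:
  assumes "strongly_convex_on nrm X \<nu> \<pi>" "gradient_on X \<pi> g\<pi>" "x \<in> X" "y \<in> X"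
  shows "\<nu> / 2 * (nrm (x - y))\<^sup>2 \<le> \<pi> y - \<pi> x - g\<pi> x \<bullet> (y - x)"
proof -
  define n where "n = (nrm (x - y))\<^sup>2"
  \<comment> \<open>Up to the constant \<open>\<pi> x\<close> this is the slack in the strong
    convexity inequality. The slack vanishes at \<open>0\<close>, so its derivative there is
    nonnegative, and that is the claim.\<close>
  define \<psi> where "\<psi> t = t * (\<pi> y - \<pi> x) - \<nu> / 2 * n * (t * (1 - t)) - \<pi> (x + t *\<^sub>R (y - x))" for t
  have sc: "convex X" "\<And>t. 0 \<le> t \<Longrightarrow> t \<le> 1 \<Longrightarrow>
      \<pi> ((1 - t) *\<^sub>R x + t *\<^sub>R y) \<le> (1 - t) * \<pi> x + t * \<pi> y - \<nu> / 2 * t * (1 - t) * n"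
    using assms unfolding strongly_convex_on_def n_def by auto
  have "(\<psi> has_real_derivative ((\<pi> y - \<pi> x) - \<nu> / 2 * n - g\<pi> x \<bullet> (y - x))) (at 0 within {0..1})"
    unfolding \<psi>_def
    by (auto intro!: derivative_eq_intros gradient_along_segment[OF assms(2) sc(1) assms(3,4)])
  moreover have "\<psi> 0 \<le> \<psi> t" if "0 \<le> t" "t \<le> 1" for t
  proof -
    have "x + t *\<^sub>R (y - x) = (1 - t) *\<^sub>R x + t *\<^sub>R y" by (simp add: algebra_simps)
    with sc(2)[OF that] show ?thesis by (simp add: \<psi>_def algebra_simps)
  qed
  ultimately have "0 \<le> (\<pi> y - \<pi> x) - \<nu> / 2 * n - g\<pi> x \<bullet> (y - x)"
    by (rule min_at_left_endpoint_deriv_nonneg)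
  then show ?thesis by (simp add: n_def)
qed

lemma gradient_on_continuous_on: "gradient_on X F gF \<Longrightarrow> continuous_on X F"
  using has_derivative_continuous_on[of X F "\<lambda>x d. gF x \<bullet> d"] by (simp add: gradient_on_def)

text \<open>This is the numerical core of the strict bound on \<open>N_h\<close>. The margin is
  small: \<open>(1 + ln 3) * sqrt 2\<close> is about 2.968, to be compared with 3.\<close>

lemma ln_3_bound: "1 + ln 3 < 3 / sqrt (2::real)"
proof -
  \<comment> \<open>The quadratic Taylor bound at 1 gives only 2.5 for \<open>exp 1\<close>, which
    is too weak here; at 1/4, raised to the fourth power, it gives more than 2.69.\<close>
  have "(1.28125::real) \<le> exp (1/4)"
    using exp_lower_Taylor_quadratic[of "1/4::real"] by (simp add: power2_eq_square)
  then have "(1.28125::real) ^ 4 \<le> exp (1/4) ^ 4" by (intro power_mono) auto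
  also have "exp (1/4::real) ^ 4 = exp 1" by (simp flip: exp_of_nat_mult)
  finally have e: "(269/100::real) < exp 1" by (simp add: power4_eq_xxxx)
  have "ln (3::real) = 1 + ln (3 / exp 1)" by (simp add: ln_div)
  also have "ln (3 / exp 1) \<le> 3 / exp 1 - (1::real)" by (rule ln_le_minus_one) simp
  also have "3 / exp 1 < (3 / (269/100) :: real)" using e by (intro divide_strict_left_mono) auto
  finally have "1 + ln (3::real) < 2.118" by simp
  moreover have "sqrt (2::real) < 1.415" by (rule real_less_lsqrt) (auto simp: power2_eq_square)
  then have "3 / 1.415 < 3 / sqrt (2::real)" by (intro divide_strict_left_mono) auto
  ultimately show ?thesis by simp
qed

section \<open>The composite problem and a single prox step\<close>

text \<open>The potential \<open>\<pi>\<close> behind \<open>V\<close> is fixed together with its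
  gradient, so that the optimality condition of a prox step can be written through
  \<open>g\<pi>\<close>.\<close>

locale composite_prox =
  fixes X :: "'a::euclidean_space set" and nrm :: "'a \<Rightarrow> real"
    and f h :: "'a \<Rightarrow> real" and gf gh :: "'a \<Rightarrow> 'a"
    and V :: "'a \<Rightarrow> 'a \<Rightarrow> real" and L M \<mu> \<nu> :: real
    and \<pi> :: "'a \<Rightarrow> real" and g\<pi> :: "'a \<Rightarrow> 'a"
  assumes norm_fun: "norm_fun nrm"
    and closed_X: "closed X" and convex_X: "convex X"
    and grad_f: "gradient_on X f gf" and grad_h: "gradient_on X h gh"
    and pos: "L > 0" "M > 0" "\<mu> > 0" "\<nu> > 0" and L_le_M: "L \<le> M"
    and f_lower: "\<And>x u. x \<in> X \<Longrightarrow> u \<in> X \<Longrightarrow>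
      \<mu> / 2 * (nrm (x - u))\<^sup>2 \<le> f x - linearization f gf u x"
    and f_upper: "\<And>x u. x \<in> X \<Longrightarrow> u \<in> X \<Longrightarrow>
      f x - linearization f gf u x \<le> L / 2 * (nrm (x - u))\<^sup>2"
    and h_lower: "\<And>x u. x \<in> X \<Longrightarrow> u \<in> X \<Longrightarrow> 0 \<le> h x - linearization h gh u x"
    and h_upper: "\<And>x u. x \<in> X \<Longrightarrow> u \<in> X \<Longrightarrow>
      h x - linearization h gh u x \<le> M / 2 * (nrm (x - u))\<^sup>2"
    and sc_\<pi>: "strongly_convex_on nrm X \<nu> \<pi>" and grad_\<pi>: "gradient_on X \<pi> g\<pi>"
    and V_eq: "\<And>x u. x \<in> X \<Longrightarrow> u \<in> X \<Longrightarrow> V x u = \<pi> u - \<pi> x - g\<pi> x \<bullet> (u - x)"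
    and V_upper: "\<And>x u. x \<in> X \<Longrightarrow> u \<in> X \<Longrightarrow> V x u \<le> 1 / 2 * (nrm (x - u))\<^sup>2"
begin

lemma nrm_zero [simp]: "nrm 0 = 0"
  and nrm_scale: "nrm (c *\<^sub>R x) = \<bar>c\<bar> * nrm x"
  and nrm_triangle: "nrm (x + y) \<le> nrm x + nrm y"
  using norm_fun unfolding norm_fun_def by blast+

lemma nrm_minus_commute: "nrm (x - y) = nrm (y - x)"
  using nrm_scale[of "-1" "x - y"] by simp

lemma nrm_nonneg [simp]: "0 \<le> nrm x"
  using nrm_triangle[of x "- x"] nrm_scale[of "-1" x] by simp

lemma V_lower:
  assumes "x \<in> X" "u \<in> X"
  shows "\<nu> / 2 * (nrm (u - x))\<^sup>2 \<le> V x u"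
  using strongly_convex_on_gradient_ineq[OF sc_\<pi> grad_\<pi> assms] assms
  by (simp add: V_eq nrm_minus_commute)

lemma V_nonneg: "x \<in> X \<Longrightarrow> u \<in> X \<Longrightarrow> 0 \<le> V x u"
  by (rule order_trans[OF _ V_lower]) (use pos in auto)

text \<open>With this identity the variational inequality at a prox point turns into a comparison of
  Bregman distances.\<close>

lemma V_three_point:
  assumes "x \<in> X" "z \<in> X" "u \<in> X"
  shows "V x u = V x z + V z u + (g\<pi> z - g\<pi> x) \<bullet> (u - z)"
  using assms by (simp add: V_eq inner_diff_left inner_diff_right)

text \<open>\<open>ARG_MIN\<close> is a choice operator and says something only once some minimizer
  \<open>m\<close> is known to exist.\<close>

lemma arg_min_in:
  fixes F :: "'a \<Rightarrow> real"
  assumes "m \<in> X" "\<And>y. y \<in> X \<Longrightarrow> F m \<le> F y" "z = (ARG_MIN F w. w \<in> X)"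
  shows "z \<in> X" "\<And>y. y \<in> X \<Longrightarrow> F z \<le> F y"
proof -
  have "is_arg_min F (\<lambda>w. w \<in> X) z"
    unfolding assms(3) arg_min_def
    by (rule someI[of _ m]) (use assms in \<open>auto simp: is_arg_min_def not_less\<close>)
  then show "z \<in> X" "\<And>y. y \<in> X \<Longrightarrow> F z \<le> F y"
    by (auto simp: is_arg_min_def not_less)
qed

text \<open>The objective is affine plus Bregman terms. The variational inequality at
  \<open>z\<close>, combined with the three-point identity for both terms, leaves
  \<open>(\<beta> + b) * V z u\<close> as the gain.\<close>

lemma prox_step:
  assumes A: "\<And>y z. A y = A z + a \<bullet> (y - z)"
    and X: "x \<in> X" "w \<in> X" and \<beta>: "\<beta> > 0" and b: "b \<ge> 0"
    and z: "z = (ARG_MIN (\<lambda>y. A y + \<beta> * V x y + b * V w y) y. y \<in> X)"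
  shows "z \<in> X"
    and "\<And>u. u \<in> X \<Longrightarrow> A z + \<beta> * V x z + b * V w z + (\<beta> + b) * V z u
                      \<le> A u + \<beta> * V x u + b * V w u"
proof -
  \<comment> \<open>\<open>V\<close> is described only on \<open>X\<close>; spelling the objective
    out in \<open>\<pi>\<close> allows its gradient map \<open>G\<close> to be computed.\<close>
  define F where "F y = A x + a \<bullet> (y - x) + \<beta> * (\<pi> y - \<pi> x - g\<pi> x \<bullet> (y - x))
    + b * (\<pi> y - \<pi> w - g\<pi> w \<bullet> (y - w))" for y
  have F: "A y + \<beta> * V x y + b * V w y = F y" if "y \<in> X" for y
    using that X A[of y x] by (simp add: F_def V_eq)
  define G where "G y = a + \<beta> *\<^sub>R (g\<pi> y - g\<pi> x) + b *\<^sub>R (g\<pi> y - g\<pi> w)" for y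
  have grad: "gradient_on X F G"
    using grad_\<pi> unfolding gradient_on_def F_def G_def
    by (auto intro!: derivative_eq_intros simp: inner_add_left inner_diff_left algebra_simps)
  \<comment> \<open>Centred at \<open>x\<close>, the term \<open>\<beta> * V x y\<close> has zero
    slope, so only the affine part and the \<open>b\<close>-term contribute one. Growth is taken
    from \<open>\<beta>\<close> because \<open>b\<close> may be 0.\<close>
  have low: "F x + (b *\<^sub>R (g\<pi> x - g\<pi> w) + a) \<bullet> (y - x) + \<beta> * \<nu> / 2 * (nrm (y - x))\<^sup>2 \<le> F y"
    if "y \<in> X" for y
  proof -
    have "F y = F x + (b *\<^sub>R (g\<pi> x - g\<pi> w) + a) \<bullet> (y - x) + (\<beta> + b) * V x y"
      using X that by (simp add: F_def V_eq algebra_simps inner_simps)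
    moreover have "\<beta> * (\<nu> / 2 * (nrm (y - x))\<^sup>2) \<le> \<beta> * V x y"
      using V_lower[OF X(1) that] \<beta> by (intro mult_left_mono) auto
    moreover have "0 \<le> b * V x y" using b V_nonneg[OF X(1) that] by simp
    ultimately show ?thesis by (simp add: algebra_simps)
  qed
  obtain m where m: "m \<in> X" "\<And>y. y \<in> X \<Longrightarrow> F m \<le> F y"
    using quadratic_growth_attains_min[OF norm_fun closed_X X(1)
        gradient_on_continuous_on[OF grad] _ low] \<beta> pos by auto
  have zX: "z \<in> X" and zmin: "\<And>y. y \<in> X \<Longrightarrow> F z \<le> F y"
    using arg_min_in[of m "\<lambda>y. A y + \<beta> * V x y + b * V w y" z] m z by (auto simp: F)
  then show "z \<in> X" by simp
  fix u assume u: "u \<in> X"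
  have "0 \<le> G z \<bullet> (u - z)"
    by (rule first_order_optimality[OF grad convex_X zX u zmin])
  moreover have "\<beta> * V x u + b * V w u = \<beta> * V x z + b * V w z + (\<beta> + b) * V z u
      + (\<beta> *\<^sub>R (g\<pi> z - g\<pi> x) + b *\<^sub>R (g\<pi> z - g\<pi> w)) \<bullet> (u - z)"
    unfolding V_three_point[OF X(1) zX u] V_three_point[OF X(2) zX u]
    by (simp add: algebra_simps inner_add_left)
  ultimately show "A z + \<beta> * V x z + b * V w z + (\<beta> + b) * V z u
      \<le> A u + \<beta> * V x u + b * V w u"
    using A[of u z] by (simp add: G_def inner_add_left)
qed

lemma convex_comb3:
  assumes "x \<in> X" "y \<in> X" "z \<in> X" "0 \<le> c" "c \<le> 1" "0 \<le> a" "a \<le> (1::real)"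
  shows "(1 - c) *\<^sub>R x + (c * (1 - a)) *\<^sub>R y + (c * a) *\<^sub>R z \<in> X"
proof -
  have "(1 - c) *\<^sub>R x + c *\<^sub>R ((1 - a) *\<^sub>R y + a *\<^sub>R z) \<in> X"
    using assms convex_X by (intro convexD_alt) auto
  then show ?thesis by (simp add: algebra_simps)
qed

section \<open>The inner loop\<close>

text \<open>The linear model of \<open>h\<close> lies below \<open>h\<close> at the points being
  averaged. At the new point it errs by at most \<open>M / 2\<close> times a squared distance; this
  distance is \<open>ll * a\<close> times that of \<open>w'\<close> from \<open>w\<close>, so
  \<open>cond\<close> lets \<open>b * V w w'\<close> pay for the error.\<close>

lemma prox_ag_step:
  fixes g :: "'a \<Rightarrow> real"
  assumes g: "\<And>y z. g y = g z + c \<bullet> (y - z)"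
    and X: "x \<in> X" "xbar \<in> X" "w \<in> X" "wt \<in> X"
    and ll: "0 \<le> ll" "ll \<le> 1" and a: "0 \<le> a" "a \<le> 1" and \<beta>: "\<beta> > 0" and b: "0 \<le> b"
    and cond: "M * ll * a \<le> \<nu> * b"
    and ul: "ul = (1 - ll) *\<^sub>R xbar + (ll * (1 - a)) *\<^sub>R wt + (ll * a) *\<^sub>R w"
    and w': "w' = (ARG_MIN (\<lambda>y. g y + linearization h gh ul y + \<beta> * V x y + b * V w y) y. y \<in> X)"
    and wt': "wt' = (1 - a) *\<^sub>R wt + a *\<^sub>R w'"
    and G: "\<And>y. G y = g y + h y"
  shows "w' \<in> X" and "wt' \<in> X"
    and "\<And>u. u \<in> X \<Longrightarrow>
      G ((1 - ll) *\<^sub>R xbar + ll *\<^sub>R wt') - (1 - ll) * G xbar - ll * G u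
      \<le> (1 - a) * (G ((1 - ll) *\<^sub>R xbar + ll *\<^sub>R wt) - (1 - ll) * G xbar - ll * G u)
        + a * ll * (\<beta> * V x u + b * V w u - (\<beta> + b) * V w' u - \<beta> * V x w')"
proof -
  define lh where "lh = linearization h gh ul"
  have A: "g y + lh y = g z + lh z + (c + gh ul) \<bullet> (y - z)" for y z
    using g[of y z] by (simp add: lh_def linearization_def inner_simps)
  note P = prox_step[where A = "\<lambda>y. g y + lh y", OF A X(1,3) \<beta> b, of w', folded w'[folded lh_def]]
  show w'X: "w' \<in> X" using P(1) w' by (simp add: lh_def)
  show wt'X: "wt' \<in> X" unfolding wt' using X w'X a convex_X by (intro convexD_alt) auto
  have ulX: "ul \<in> X" unfolding ul using X ll a by (intro convex_comb3) auto
  define y where "y = (1 - ll) *\<^sub>R xbar + ll *\<^sub>R wt"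
  define y' where "y' = (1 - ll) *\<^sub>R xbar + ll *\<^sub>R wt'"
  have yX: "y \<in> X" and y'X: "y' \<in> X"
    unfolding y_def y'_def using X wt'X ll convex_X by (auto intro!: convexD_alt)
  \<comment> \<open>The three weights add up to 1, so affine functions respect the decomposition
    exactly.\<close>
  have y'_comb: "y' = (1 - a) *\<^sub>R y + (a * (1 - ll)) *\<^sub>R xbar + (a * ll) *\<^sub>R w'"
    by (simp add: y'_def y_def wt' algebra_simps)
  fix u assume u: "u \<in> X"
  have affine: "g y' + lh y' = (1 - a) * (g y + lh y) + a * (1 - ll) * (g xbar + lh xbar)
      + a * ll * (g w' + lh w')"
  proof -
    have "(c + gh ul) \<bullet> y' = (1 - a) * ((c + gh ul) \<bullet> y)
        + a * (1 - ll) * ((c + gh ul) \<bullet> xbar) + a * ll * ((c + gh ul) \<bullet> w')"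
      by (simp only: y'_comb inner_add_right inner_scaleR_right)
    moreover have "g v + lh v = g 0 + lh 0 + (c + gh ul) \<bullet> v" for v
      using A[of v 0] by simp
    ultimately show ?thesis by (simp add: algebra_simps)
  qed
  have lh_le: "lh v \<le> h v" if "v \<in> X" for v
    using h_lower[OF that ulX] by (simp add: lh_def)
  have "y' - ul = (ll * a) *\<^sub>R (w' - w)"
    by (simp add: y'_def ul wt' algebra_simps)
  then have nrm_y': "(nrm (y' - ul))\<^sup>2 = (ll * a)\<^sup>2 * (nrm (w' - w))\<^sup>2"
    by (simp add: nrm_scale power_mult_distrib)
  have quad: "M / 2 * (nrm (y' - ul))\<^sup>2 \<le> a * ll * (b * V w w')"
  proof -
    have "M / 2 * (nrm (y' - ul))\<^sup>2 = (M * ll * a) * (a * ll / 2 * (nrm (w' - w))\<^sup>2)"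
      unfolding nrm_y' by (simp add: power2_eq_square)
    also have "\<dots> \<le> (\<nu> * b) * (a * ll / 2 * (nrm (w' - w))\<^sup>2)"
      using cond a ll by (intro mult_right_mono) auto
    also have "\<dots> = a * ll * b * (\<nu> / 2 * (nrm (w' - w))\<^sup>2)" by simp
    also have "\<dots> \<le> a * ll * b * V w w'"
      using V_lower[OF X(3) w'X] a ll b by (intro mult_left_mono) auto
    finally show ?thesis by (simp add: algebra_simps)
  qed
  have "h y' \<le> lh y' + M / 2 * (nrm (y' - ul))\<^sup>2"
    using h_upper[OF y'X ulX] by (simp add: lh_def)
  moreover have "(1 - a) * (g y + lh y) \<le> (1 - a) * G y"
    using lh_le[OF yX] a by (intro mult_left_mono) (auto simp: G)
  moreover have "a * (1 - ll) * (g xbar + lh xbar) \<le> a * (1 - ll) * G xbar"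
    using lh_le[OF X(2)] a ll by (intro mult_left_mono) (auto simp: G)
  moreover have "a * ll * (g w' + lh w' + \<beta> * V x w' + b * V w w' + (\<beta> + b) * V w' u)
      \<le> a * ll * (G u + \<beta> * V x u + b * V w u)"
    using P(2)[OF refl u] lh_le[OF u] a ll w' by (intro mult_left_mono) (auto simp: G lh_def)
  ultimately have "G y' \<le> (1 - a) * G y + a * (1 - ll) * G xbar
      + a * ll * (G u + \<beta> * V x u + b * V w u - (\<beta> + b) * V w' u - \<beta> * V x w')"
    using affine quad by (simp add: G[of y'] algebra_simps)
  then show "G ((1 - ll) *\<^sub>R xbar + ll *\<^sub>R wt') - (1 - ll) * G xbar - ll * G u
      \<le> (1 - a) * (G ((1 - ll) *\<^sub>R xbar + ll *\<^sub>R wt) - (1 - ll) * G xbar - ll * G u)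
        + a * ll * (\<beta> * V x u + b * V w u - (\<beta> + b) * V w' u - \<beta> * V x w')"
    unfolding y_def y'_def by (simp add: algebra_simps)
qed


text \<open>
  \<open>B\<close> stands for the weighted sum of the \<open>V x u\<^sub>t\<close>. Its lower bound by the squared norm of the
  weighted sum of the \<open>u\<^sub>t - x\<close> (Jensen) is stated as a family of bounds linear in that norm,
  indexed by \<open>s\<close>, because such bounds are preserved step by step.
\<close>

lemma prox_ag_invariant:
  fixes g :: "'a \<Rightarrow> real" and \<theta> R \<alpha> p q :: "nat \<Rightarrow> real"
  assumes g: "\<And>y z. g y = g z + c \<bullet> (y - z)"
    and X: "x \<in> X" "xbar \<in> X" "u \<in> X"
    and ll: "0 \<le> ll" "ll \<le> 1" and \<beta>: "\<beta> > 0"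
    and \<theta>: "\<And>t. 0 \<le> \<theta> t" "\<forall>t<T. \<theta> (Suc t) * (1 - \<alpha> (Suc t)) = \<theta> t"
    and \<alpha>: "\<forall>t<T. 0 \<le> \<alpha> (Suc t)" "\<forall>t<T. \<alpha> (Suc t) \<le> 1"
    and R: "\<forall>t<T. \<theta> (Suc t) * \<alpha> (Suc t) * (\<beta> * p (Suc t) + q (Suc t)) = R t"
      "\<forall>t<T. R (Suc t) = R t + \<beta> * (\<theta> (Suc t) - \<theta> t)"
    and cond: "\<forall>t<T. M * ll * \<alpha> (Suc t) \<le> \<nu> * (\<beta> * p (Suc t) + q (Suc t))"
    and G: "\<And>y. G y = g y + h y"
    and t: "t \<le> T" and run: "prox_ag X h gh V \<alpha> p q g xbar x ll \<beta> t = (w, wt, n)"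
  shows "w \<in> X \<and> wt \<in> X \<and> n = t \<and>
    (\<exists>B. \<theta> t * (G ((1 - ll) *\<^sub>R xbar + ll *\<^sub>R wt) - (1 - ll) * G xbar - ll * G u)
          \<le> \<theta> 0 * ll * (G xbar - G u) + ll * (R t * (V x u - V w u) - \<beta> * B) \<and>
        (\<forall>s\<ge>0. \<nu> / 2 * (2 * s * nrm (\<theta> t *\<^sub>R wt - \<theta> 0 *\<^sub>R xbar - (\<theta> t - \<theta> 0) *\<^sub>R x)
            - s\<^sup>2 * (\<theta> t - \<theta> 0)) \<le> B))"
  using t run
proof (induction t arbitrary: w wt n)
  case 0
  have "(1 - ll) *\<^sub>R xbar + ll *\<^sub>R xbar = xbar" by (simp add: algebra_simps)
  \<comment> \<open>\<open>B = 0\<close> is the empty sum; the vector inside the norm is zero at the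
    start.\<close>
  with 0 X show ?case by (auto intro!: exI[of _ 0] simp: algebra_simps)
next
  case (Suc t)
  obtain w0 wt0 n0 where run0: "prox_ag X h gh V \<alpha> p q g xbar x ll \<beta> t = (w0, wt0, n0)"
    by (metis prod_cases3)
  have tT: "t < T" using Suc.prems by simp
  then obtain B where IH: "w0 \<in> X" "wt0 \<in> X" "n0 = t"
    "\<theta> t * (G ((1 - ll) *\<^sub>R xbar + ll *\<^sub>R wt0) - (1 - ll) * G xbar - ll * G u)
          \<le> \<theta> 0 * ll * (G xbar - G u) + ll * (R t * (V x u - V w0 u) - \<beta> * B)"
    "\<And>s. 0 \<le> s \<Longrightarrow> \<nu> / 2 * (2 * s * nrm (\<theta> t *\<^sub>R wt0 - \<theta> 0 *\<^sub>R xbar - (\<theta> t - \<theta> 0) *\<^sub>R x)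
            - s\<^sup>2 * (\<theta> t - \<theta> 0)) \<le> B"
    using Suc.IH[OF _ run0] by auto
  define a where "a = \<alpha> (Suc t)"
  define b where "b = \<beta> * p (Suc t) + q (Suc t)"
  define ul where "ul = (1 - ll) *\<^sub>R xbar + (ll * (1 - a)) *\<^sub>R wt0 + (ll * a) *\<^sub>R w0"
  have w: "w = (ARG_MIN (\<lambda>y. g y + linearization h gh ul y + \<beta> * V x y + b * V w0 y) y. y \<in> X)"
    and wt: "wt = (1 - a) *\<^sub>R wt0 + a *\<^sub>R w" and n: "n = Suc t"
    using Suc.prems(2) IH(3) by (auto simp: run0 a_def b_def ul_def Let_def)
  have a: "0 \<le> a" "a \<le> 1" using \<alpha> tT by (auto simp: a_def)
  have Mb: "M * ll * a \<le> \<nu> * b" using cond[rule_format, OF tT] by (simp add: a_def b_def)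
  \<comment> \<open>Nonnegativity of the prox weight \<open>b\<close> is read off from
    \<open>cond\<close>.\<close>
  then have "0 \<le> \<nu> * b" using pos a ll by (auto intro: order_trans[rotated])
  then have b: "0 \<le> b" using pos by (simp add: zero_le_mult_iff)
  note step = prox_ag_step[OF g X(1,2) IH(1,2) ll a \<beta> b Mb ul_def w wt G]
  let ?\<theta> = "\<theta> (Suc t)" and ?D = "G ((1 - ll) *\<^sub>R xbar + ll *\<^sub>R wt0) - (1 - ll) * G xbar - ll * G u"
  \<comment> \<open>The weight of the new inner iterate in \<open>?\<theta> *\<^sub>R wt\<close>,
    equal to the increment of \<open>\<theta>\<close>. Multiplied by \<open>\<tau>\<close>, the
    distance terms carry the coefficients \<open>R t\<close> and \<open>R (Suc t)\<close>, hence
    they telescope.\<close>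
  define \<tau> where "\<tau> = ?\<theta> * a"
  have "?\<theta> - \<theta> t = \<tau>"
    using \<theta>(2)[rule_format, OF tT] by (simp add: \<tau>_def a_def algebra_simps)
  with R(2)[rule_format, OF tT] have R2: "R (Suc t) = R t + \<beta> * \<tau>" by simp
  have \<tau>: "?\<theta> * (1 - a) = \<theta> t" "\<tau> * b = R t" "R (Suc t) = R t + \<beta> * \<tau>"
      "?\<theta> = \<theta> t + \<tau>" "0 \<le> \<tau>"
    using \<theta>(2)[rule_format, OF tT] R(1)[rule_format, OF tT] R2 a(1) \<theta>(1)[of "Suc t"]
    by (auto simp: a_def b_def \<tau>_def algebra_simps)
  have "?\<theta> * (G ((1 - ll) *\<^sub>R xbar + ll *\<^sub>R wt) - (1 - ll) * G xbar - ll * G u)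
      \<le> ?\<theta> * ((1 - a) * ?D + a * ll * (\<beta> * V x u + b * V w0 u - (\<beta> + b) * V w u - \<beta> * V x w))"
    using step(3)[OF X(3)] \<theta>(1) by (intro mult_left_mono) auto
  also have "\<dots> = \<theta> t * ?D + ll * ((\<beta> * \<tau>) * V x u + (\<tau> * b) * V w0 u
      - (\<beta> * \<tau> + \<tau> * b) * V w u - \<beta> * (\<tau> * V x w))"
    unfolding \<tau>(1)[symmetric] by (simp add: \<tau>_def algebra_simps)
  also have "\<dots> \<le> \<theta> 0 * ll * (G xbar - G u)
      + ll * (R (Suc t) * (V x u - V w u) - \<beta> * (B + \<tau> * V x w))"
    using IH(4) unfolding \<tau>(2,3) by (simp add: algebra_simps)
  finally have main: "?\<theta> * (G ((1 - ll) *\<^sub>R xbar + ll *\<^sub>R wt) - (1 - ll) * G xbar - ll * G u)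
    \<le> \<theta> 0 * ll * (G xbar - G u) + ll * (R (Suc t) * (V x u - V w u) - \<beta> * (B + \<tau> * V x w))" .
  have "\<nu> / 2 * (2 * s * nrm (?\<theta> *\<^sub>R wt - \<theta> 0 *\<^sub>R xbar - (?\<theta> - \<theta> 0) *\<^sub>R x)
            - s\<^sup>2 * (?\<theta> - \<theta> 0)) \<le> B + \<tau> * V x w" if s: "0 \<le> s" for s
  proof -
    define r where "r = \<theta> t *\<^sub>R wt0 - \<theta> 0 *\<^sub>R xbar - (\<theta> t - \<theta> 0) *\<^sub>R x"
    have "?\<theta> *\<^sub>R wt = \<theta> t *\<^sub>R wt0 + \<tau> *\<^sub>R w"
      unfolding wt \<tau>_def \<tau>(1)[symmetric] by (simp add: algebra_simps)
    then have "?\<theta> *\<^sub>R wt - \<theta> 0 *\<^sub>R xbar - (?\<theta> - \<theta> 0) *\<^sub>R x = r + \<tau> *\<^sub>R (w - x)"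
      by (simp add: r_def \<tau>(4) algebra_simps)
    then have nr: "nrm (?\<theta> *\<^sub>R wt - \<theta> 0 *\<^sub>R xbar - (?\<theta> - \<theta> 0) *\<^sub>R x) \<le> nrm r + \<tau> * nrm (w - x)"
      using nrm_triangle[of r "\<tau> *\<^sub>R (w - x)"] \<tau>(5) by (simp add: nrm_scale)
    \<comment> \<open>The tangent of the square at \<open>s\<close> is linear in the norm, so the
      triangle inequality can add this step to the earlier ones.\<close>
    have "0 \<le> (nrm (w - x) - s)\<^sup>2" by simp
    then have "\<nu> / 2 * (2 * s * nrm (w - x) - s\<^sup>2) \<le> \<nu> / 2 * (nrm (w - x))\<^sup>2"
      using pos by (intro mult_left_mono) (auto simp: power2_eq_square algebra_simps)
    also have "\<dots> \<le> V x w" by (rule V_lower[OF X(1) step(1)])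
    finally have "\<tau> * (\<nu> / 2 * (2 * s * nrm (w - x) - s\<^sup>2)) \<le> \<tau> * V x w"
      using \<tau>(5) by (rule mult_left_mono)
    moreover have "\<nu> * s * nrm (?\<theta> *\<^sub>R wt - \<theta> 0 *\<^sub>R xbar - (?\<theta> - \<theta> 0) *\<^sub>R x)
        \<le> \<nu> * s * (nrm r + \<tau> * nrm (w - x))"
      using nr s pos by (intro mult_left_mono) auto
    ultimately show ?thesis
      using IH(5)[OF s, folded r_def] unfolding \<tau>(4) by (simp add: algebra_simps)
  qed
  with main step(1,2) n show ?case by blast
qed

section \<open>One outer step under abstract parameter conditions\<close>

text \<open>The relation \<open>ll * (\<theta> T - \<theta> 0) = \<gamma> * \<theta> T\<close> has
  two effects: the old gap enters with factor \<open>1 - \<gamma>\<close>, and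
  \<open>xbar' - xl\<close> becomes a multiple of the accumulated displacement \<open>r\<close>.
  Then \<open>\<beta> * B\<close> covers the smoothness error of \<open>f\<close> because
  \<open>L * \<gamma> \<le> \<beta> * \<nu>\<close>.\<close>

lemma ags_step:
  fixes \<theta> R \<alpha> p q :: "nat \<Rightarrow> real"
  assumes X: "x \<in> X" "xbar \<in> X"
    and ll: "0 \<le> ll" "ll \<le> 1" and \<beta>: "\<beta> > 0" and \<gamma>: "0 \<le> \<gamma>" "\<gamma> \<le> 1"
    and \<theta>: "\<And>t. 0 \<le> \<theta> t" "\<forall>t<T. \<theta> (Suc t) * (1 - \<alpha> (Suc t)) = \<theta> t" "\<theta> 0 < \<theta> T"
    and \<alpha>: "\<forall>t<T. 0 \<le> \<alpha> (Suc t)" "\<forall>t<T. \<alpha> (Suc t) \<le> 1"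
    and R: "\<forall>t<T. \<theta> (Suc t) * \<alpha> (Suc t) * (\<beta> * p (Suc t) + q (Suc t)) = R t"
      "\<forall>t<T. R (Suc t) = R t + \<beta> * (\<theta> (Suc t) - \<theta> t)"
    and cond: "\<forall>t<T. M * ll * \<alpha> (Suc t) \<le> \<nu> * (\<beta> * p (Suc t) + q (Suc t))"
    and \<gamma>_eq: "ll * (\<theta> T - \<theta> 0) = \<gamma> * \<theta> T" and L\<gamma>: "L * \<gamma> \<le> \<beta> * \<nu>"
    and xl: "xl = (1 - \<gamma>) *\<^sub>R xbar + \<gamma> *\<^sub>R x"
    and run: "prox_ag X h gh V \<alpha> p q (linearization f gf xl) xbar x ll \<beta> T = (x', xt, n)"
    and xbar': "xbar' = (1 - ll) *\<^sub>R xbar + ll *\<^sub>R xt"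
  shows "x' \<in> X \<and> xbar' \<in> X \<and> n = T \<and> (\<forall>u\<in>X. f xbar' + h xbar' - (f u + h u)
      \<le> (1 - \<gamma>) * (f xbar + h xbar - (f u + h u)) + ll * R T / \<theta> T * (V x u - V x' u))"
proof -
  define G where "G y = linearization f gf xl y + h y" for y
  have g: "linearization f gf xl y = linearization f gf xl z + gf xl \<bullet> (y - z)" for y z
    by (simp add: linearization_def inner_diff_right)
  have xlX: "xl \<in> X" unfolding xl using X \<gamma> convex_X by (intro convexD_alt) auto
  note inv = prox_ag_invariant[OF g X _ ll \<beta> \<theta>(1,2) \<alpha> R cond G_def order_refl run]
  have x'X: "x' \<in> X" and xtX: "xt \<in> X" and n: "n = T" using inv[OF X(1)] by auto
  have xbar'X: "xbar' \<in> X" unfolding xbar' using X xtX ll convex_X by (intro convexD_alt) auto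
  have \<theta>T: "\<theta> T > 0" using \<theta>(1)[of 0] \<theta>(3) by simp
  have "f xbar' + h xbar' - (f u + h u)
      \<le> (1 - \<gamma>) * (f xbar + h xbar - (f u + h u)) + ll * R T / \<theta> T * (V x u - V x' u)"
    if u: "u \<in> X" for u
  proof -
    define r where "r = \<theta> T *\<^sub>R xt - \<theta> 0 *\<^sub>R xbar - (\<theta> T - \<theta> 0) *\<^sub>R x"
    obtain B where B: "\<theta> T * (G xbar' - (1 - ll) * G xbar - ll * G u)
          \<le> \<theta> 0 * ll * (G xbar - G u) + ll * (R T * (V x u - V x' u) - \<beta> * B)"
        "\<And>s. 0 \<le> s \<Longrightarrow> \<nu> / 2 * (2 * s * nrm r - s\<^sup>2 * (\<theta> T - \<theta> 0)) \<le> B"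
      using inv[OF u] unfolding xbar'[symmetric] r_def by auto
    \<comment> \<open>This \<open>s\<close> maximizes
      \<open>2 * s * nrm r - s\<^sup>2 * (\<theta> T - \<theta> 0)\<close> and so recovers the
      Jensen bound from the linear family.\<close>
    define s where "s = nrm r / (\<theta> T - \<theta> 0)"
    have d: "0 < \<theta> T - \<theta> 0" using \<theta>(3) by simp
    have sr: "nrm r = s * (\<theta> T - \<theta> 0)" "0 \<le> s" using d by (auto simp: s_def)
    have Bs: "\<nu> / 2 * (s\<^sup>2 * (\<theta> T - \<theta> 0)) \<le> B"
      using B(2)[OF sr(2)] by (simp add: sr(1) power2_eq_square algebra_simps)
    have ll0: "ll * \<theta> 0 = (ll - \<gamma>) * \<theta> T" using \<gamma>_eq by (simp add: algebra_simps)
    have "\<theta> T *\<^sub>R (xbar' - xl) = ll *\<^sub>R r"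
    proof -
      have "ll *\<^sub>R r = (ll * \<theta> T) *\<^sub>R xt - (ll * \<theta> 0) *\<^sub>R xbar - (ll * (\<theta> T - \<theta> 0)) *\<^sub>R x"
        by (simp add: r_def algebra_simps)
      then show ?thesis unfolding ll0 \<gamma>_eq xbar' xl by (simp add: algebra_simps)
    qed
    then have "\<theta> T * nrm (xbar' - xl) = ll * nrm r"
      using \<theta>T ll nrm_scale[of "\<theta> T" "xbar' - xl"] nrm_scale[of ll r] by simp
    also have "\<dots> = s * (ll * (\<theta> T - \<theta> 0))" by (simp add: sr(1))
    finally have dist: "nrm (xbar' - xl) = s * \<gamma>" using \<theta>T unfolding \<gamma>_eq by simp
    have "\<theta> T * (L / 2 * (nrm (xbar' - xl))\<^sup>2) = s\<^sup>2 * (\<gamma> * \<theta> T) / 2 * (L * \<gamma>)"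
      by (simp add: dist power2_eq_square)
    also have "\<dots> \<le> s\<^sup>2 * (\<gamma> * \<theta> T) / 2 * (\<beta> * \<nu>)"
      using \<gamma> \<theta>T L\<gamma> by (intro mult_left_mono) auto
    also have "\<dots> = ll * \<beta> * (\<nu> / 2 * (s\<^sup>2 * (\<theta> T - \<theta> 0)))"
      unfolding \<gamma>_eq[symmetric] by simp
    also have "\<dots> \<le> ll * \<beta> * B" using Bs ll \<beta> by (intro mult_left_mono) auto
    finally have quad: "\<theta> T * (L / 2 * (nrm (xbar' - xl))\<^sup>2) \<le> ll * \<beta> * B" .
    have G_le: "G v \<le> f v + h v" if "v \<in> X" for v
    proof -
      have "0 \<le> \<mu> / 2 * (nrm (v - xl))\<^sup>2" using pos by simp
      with f_lower[OF that xlX] show ?thesis by (simp add: G_def)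
    qed
    have "\<theta> T * (f xbar' + h xbar') \<le> \<theta> T * (G xbar' + L / 2 * (nrm (xbar' - xl))\<^sup>2)"
      using f_upper[OF xbar'X xlX] \<theta>T by (intro mult_left_mono) (auto simp: G_def)
    also have "\<dots> \<le> \<theta> T * ((1 - ll) * G xbar + ll * G u) + (ll * \<theta> 0) * (G xbar - G u)
        + ll * R T * (V x u - V x' u)"
      using B(1) quad by (simp add: algebra_simps)
    also have "\<dots> = \<theta> T * ((1 - \<gamma>) * G xbar + \<gamma> * G u) + ll * R T * (V x u - V x' u)"
      unfolding ll0 by (simp add: algebra_simps)
    also have "\<dots> \<le> \<theta> T * ((1 - \<gamma>) * (f xbar + h xbar) + \<gamma> * (f u + h u))
        + ll * R T * (V x u - V x' u)"
      using G_le[OF X(2)] G_le[OF u] \<gamma> \<theta>T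
      by (intro add_right_mono mult_left_mono add_mono) auto
    also have "\<dots> = \<theta> T * ((1 - \<gamma>) * (f xbar + h xbar) + \<gamma> * (f u + h u)
        + ll * R T / \<theta> T * (V x u - V x' u))"
      using \<theta>T by (simp add: field_simps)
    finally have "f xbar' + h xbar' \<le> (1 - \<gamma>) * (f xbar + h xbar) + \<gamma> * (f u + h u)
        + ll * R T / \<theta> T * (V x u - V x' u)"
      unfolding mult_le_cancel_left_pos[OF \<theta>T] .
    then show ?thesis unfolding right_diff_distrib left_diff_distrib by simp
  qed
  with x'X xbar'X n show ?thesis by blast
qed


section \<open>Verification of the concrete parameters\<close>

lemma ags_steps_1: "8 * M \<le> 7 * L * (real (ags_steps L M 1))\<^sup>2" "ags_steps L M 1 \<ge> 1"
proof -
  let ?T = "ags_steps L M 1"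
  have *: "sqrt (8 * M / (7 * L)) \<le> real ?T" "0 < sqrt (8 * M / (7 * L))"
    using pos by (auto simp: ags_steps_def real_nat_ceiling_ge)
  have "8 * M / (7 * L) \<le> (real ?T)\<^sup>2" by (rule sqrt_le_D[OF *(1)])
  then show "8 * M \<le> 7 * L * (real ?T)\<^sup>2" using pos by (simp add: field_simps)
  show "?T \<ge> 1" using * by linarith
qed

lemma sqrt_ratio_ge_1: "1 \<le> sqrt (M / L)"
  using pos L_le_M by simp

text \<open>The identity \<open>1 - a = p * a\<close> with \<open>p = sqrt (M / L)\<close> is the
  reason for pairing this momentum with this prox weight: it makes the inner recursion
  geometric.\<close>

lemma momentum_bounds:
  defines "a \<equiv> 1 / (sqrt (M / L) + 1)"
  shows "0 < a" "a < 1" "1 - a = sqrt (M / L) * a"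
proof -
  define p where "p = sqrt (M / L)"
  have "1 \<le> p" using sqrt_ratio_ge_1 by (simp add: p_def)
  then show "0 < a" "a < 1" "1 - a = sqrt (M / L) * a"
    unfolding a_def p_def[symmetric] by (auto simp: field_simps)
qed

text \<open>The ceiling of \<open>ln 3 / (- ln (1 - a))\<close> is the least number of inner steps
  after which the power has dropped to one third.\<close>

lemma momentum_power_le:
  assumes "k \<noteq> 1"
  shows "(1 - 1 / (sqrt (M / L) + 1)) ^ ags_steps L M k \<le> 1 / 3"
proof -
  define a where "a = 1 / (sqrt (M / L) + 1)"
  have a: "0 < 1 - a" "1 - a < 1" using momentum_bounds by (auto simp: a_def)
  then have "ln (1 - a) < 0" by simp
  moreover have "ln 3 / (- ln (1 - a)) \<le> real (ags_steps L M k)"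
    using assms by (simp add: ags_steps_def a_def real_nat_ceiling_ge del: divide_minus_right)
  ultimately have "ln 3 \<le> real (ags_steps L M k) * (- ln (1 - a))"
    by (subst (asm) pos_divide_le_eq) auto
  then have "ln ((1 - a) ^ ags_steps L M k) \<le> ln (1 / 3)"
    using a by (simp add: ln_realpow ln_div)
  then show ?thesis using a(1) unfolding a_def[symmetric] by (subst (asm) ln_le_cancel_iff) auto
qed

text \<open>Since the power is at most 1/3, the denominator of \<open>ags_lambda\<close> is at least
  2/3, which costs at most a factor 3/2 over \<open>ags_gamma\<close>.\<close>

lemma ags_lambda_bounds:
  assumes "k \<ge> 2"
  shows "ags_lambda L M k * (1 - (1 - 1 / (sqrt (M / L) + 1)) ^ ags_steps L M k) = ags_gamma k"
    and "0 < ags_lambda L M k" and "ags_lambda L M k \<le> 3 / (real k + 1)"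
proof -
  define e where "e = (1 - 1 / (sqrt (M / L) + 1)) ^ ags_steps L M k"
  have e: "e \<le> 1 / 3" using momentum_power_le[of k] assms by (simp add: e_def)
  have l: "ags_lambda L M k = ags_gamma k / (1 - e)" and g: "0 < ags_gamma k"
    using assms by (auto simp: ags_lambda_def e_def ags_gamma_def)
  show "ags_lambda L M k * (1 - (1 - 1 / (sqrt (M / L) + 1)) ^ ags_steps L M k) = ags_gamma k"
    using e unfolding l e_def[symmetric] by simp
  show "0 < ags_lambda L M k" using e g unfolding l by simp
  have "ags_lambda L M k \<le> ags_gamma k / (2 / 3)"
    unfolding l using e g by (intro divide_left_mono) auto
  also have "\<dots> = 3 / (real k + 1)" by (simp add: ags_gamma_def field_simps)
  finally show "ags_lambda L M k \<le> 3 / (real k + 1)" .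
qed

text \<open>Both parameter regimes lead to the same coefficient of the distance difference, which is
  what lets the outer recursion telescope from the first step on.\<close>

lemma ags_parameters_step:
  assumes k: "k \<ge> 1" and X: "x \<in> X" "xbar \<in> X"
    and xl: "xl = (1 - ags_gamma k) *\<^sub>R xbar + ags_gamma k *\<^sub>R x"
    and run: "prox_ag X h gh V (ags_alpha L M k) (ags_p L M k) (ags_q L M \<nu> k)
      (linearization f gf xl) xbar x (ags_lambda L M k) (ags_beta L M \<nu> k) (ags_steps L M k)
      = (x', xt, n)"
    and xbar': "xbar' = (1 - ags_lambda L M k) *\<^sub>R xbar + ags_lambda L M k *\<^sub>R xt"
  shows "x' \<in> X \<and> xbar' \<in> X \<and> n = ags_steps L M k \<and> (\<forall>u\<in>X. f xbar' + h xbar' - (f u + h u)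
      \<le> (1 - ags_gamma k) * (f xbar + h xbar - (f u + h u))
        + 9 * L / (\<nu> * real k * (real k + 1)) * (V x u - V x' u))"
proof (cases "k = 1")
  case True
  define T where "T = ags_steps L M 1"
  define Q where "Q = 7 * L * real T * (real T + 1) / (4 * \<nu>)"
  \<comment> \<open>\<open>\<alpha> 1 = 1\<close> forces \<open>\<theta> 0 = 0\<close>, so the weights cannot be inverse products of the \<open>1 - \<alpha> t\<close>.\<close>
  define \<theta> where "\<theta> t = real t * (real t + 1) / 2" for t
  define R where "R t = Q + L / \<nu> * \<theta> t" for t
  have T: "8 * M \<le> 7 * L * (real T)\<^sup>2" "T \<ge> 1" using ags_steps_1 by (auto simp: T_def)
  have q: "ags_q L M \<nu> k t = Q / real t" for t
    by (simp add: True ags_q_def T_def Q_def)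
  \<comment> \<open>The rounding in \<open>T\<close> makes the decreasing weight
    \<open>Q / t\<close> large enough to absorb the curvature of \<open>h\<close> at every inner
    step.\<close>
  have \<nu>Q: "2 * M \<le> \<nu> * Q"
  proof -
    have "8 * M \<le> 7 * L * (real T * (real T + 1))"
    proof -
      have "0 \<le> L * (real T * 7)" using pos by simp
      with T(1) show ?thesis by (simp add: power2_eq_square algebra_simps)
    qed
    then show ?thesis using pos by (simp add: Q_def)
  qed
  have \<theta>T: "\<theta> T > 0" using T(2) by (simp add: \<theta>_def)
  have "x' \<in> X \<and> xbar' \<in> X \<and> n = ags_steps L M k \<and> (\<forall>u\<in>X. f xbar' + h xbar' - (f u + h u)
      \<le> (1 - ags_gamma k) * (f xbar + h xbar - (f u + h u))
        + ags_lambda L M k * R (ags_steps L M k) / \<theta> (ags_steps L M k) * (V x u - V x' u))"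
  proof (rule ags_step[OF X _ _ _ _ _ _ _ _ _ _ _ _ _ _ _ xl run xbar'])
    show "\<forall>t<ags_steps L M k. \<theta> (Suc t) * (1 - ags_alpha L M k (Suc t)) = \<theta> t"
      by (simp add: True \<theta>_def ags_alpha_def field_simps)
    show "\<forall>t<ags_steps L M k. \<theta> (Suc t) * ags_alpha L M k (Suc t) *
        (ags_beta L M \<nu> k * ags_p L M k (Suc t) + ags_q L M \<nu> k (Suc t)) = R t"
    proof (intro allI impI)
      fix t
      have "\<theta> (Suc t) * ags_alpha L M k (Suc t) = real t + 1"
        by (simp add: True \<theta>_def ags_alpha_def field_simps)
      \<comment> \<open>Because \<open>q\<close> decays like \<open>1 / t\<close>, its contribution
        to \<open>R\<close> is the constant \<open>Q\<close>.\<close>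
      moreover have "(real t + 1) * (L / \<nu> * (real t / 2) + Q / (real t + 1)) = R t"
      proof -
        have "(real t + 1) * (Q / (real t + 1)) = Q"
          by (simp add: add_nonneg_eq_0_iff)
        then show ?thesis
          unfolding distrib_left[of "real t + 1"] R_def \<theta>_def by (simp only:) (simp add: mult_ac)
      qed
      moreover have "ags_beta L M \<nu> k * ags_p L M k (Suc t) + ags_q L M \<nu> k (Suc t)
          = L / \<nu> * (real t / 2) + Q / (real t + 1)"
        unfolding q by (simp add: True ags_beta_def ags_p_def add.commute)
      ultimately show "\<theta> (Suc t) * ags_alpha L M k (Suc t) *
        (ags_beta L M \<nu> k * ags_p L M k (Suc t) + ags_q L M \<nu> k (Suc t)) = R t"
        by simp
    qed
    show "\<forall>t<ags_steps L M k. R (Suc t) = R t + ags_beta L M \<nu> k * (\<theta> (Suc t) - \<theta> t)"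
      by (simp add: True R_def ags_beta_def algebra_simps)
    show "\<forall>t<ags_steps L M k. M * ags_lambda L M k * ags_alpha L M k (Suc t)
        \<le> \<nu> * (ags_beta L M \<nu> k * ags_p L M k (Suc t) + ags_q L M \<nu> k (Suc t))"
    proof (intro allI impI)
      fix t
      have "M * ags_lambda L M k * ags_alpha L M k (Suc t) = 2 * M / (real t + 2)"
        by (simp add: True ags_lambda_def ags_alpha_def algebra_simps)
      also have "\<dots> \<le> 2 * M / (real t + 1)" using pos by (intro divide_left_mono) auto
      also have "\<dots> \<le> \<nu> * Q / (real t + 1)" using \<nu>Q by (intro divide_right_mono) auto
      also have "\<dots> \<le> \<nu> * (L / \<nu> * (real t / 2) + Q / (real t + 1))"
        using pos by (simp add: distrib_left)
      also have "\<dots> = \<nu> * (ags_beta L M \<nu> k * ags_p L M k (Suc t) + ags_q L M \<nu> k (Suc t))"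
        unfolding q by (simp add: True ags_beta_def ags_p_def add.commute)
      finally show "M * ags_lambda L M k * ags_alpha L M k (Suc t)
        \<le> \<nu> * (ags_beta L M \<nu> k * ags_p L M k (Suc t) + ags_q L M \<nu> k (Suc t))" .
    qed
  qed (use \<theta>T pos in \<open>auto simp: True T_def \<theta>_def ags_lambda_def ags_beta_def ags_gamma_def ags_alpha_def\<close>)
  moreover have "ags_lambda L M k * R (ags_steps L M k) / \<theta> (ags_steps L M k)
      = 9 * L / (\<nu> * real k * (real k + 1))"
  proof -
    \<comment> \<open>\<open>Q\<close> equals \<open>7 * L / (2 * \<nu>) * \<theta> T\<close> and
      the \<open>\<beta>\<close> part adds \<open>L / \<nu> * \<theta> T\<close>; hence the
      9/2.\<close>
    have "R T = 9 * L / (2 * \<nu>) * \<theta> T"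
      using pos by (simp add: R_def Q_def \<theta>_def field_simps)
    then show ?thesis using \<theta>T by (simp add: True ags_lambda_def T_def)
  qed
  ultimately show ?thesis by simp
next
  case False
  with k have k2: "k \<ge> 2" by simp
  define p where "p = sqrt (M / L)"
  define a where "a = 1 / (p + 1)"
  define T where "T = ags_steps L M k"
  define l where "l = ags_lambda L M k"
  define \<beta> where "\<beta> = ags_beta L M \<nu> k"
  \<comment> \<open>With constant momentum the weights are geometric, and
    \<open>R t = \<beta> * \<theta> t\<close> since \<open>q\<close> is zero.\<close>
  define \<theta> where "\<theta> t = 1 / (1 - a) ^ t" for t
  have p: "1 \<le> p" "L * p\<^sup>2 = M" using sqrt_ratio_ge_1 pos by (auto simp: p_def)
  have a: "0 < a" "a < 1" "1 - a = p * a" using momentum_bounds by (auto simp: a_def p_def)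
  have pow: "(1 - a) ^ T \<le> 1 / 3" "0 < (1 - a) ^ T"
    using momentum_power_le[of k] False a by (auto simp: a_def p_def T_def)
  have l: "l * (1 - (1 - a) ^ T) = ags_gamma k" "0 < l" "l \<le> 3 / (real k + 1)"
    using ags_lambda_bounds[OF k2] by (auto simp: l_def a_def p_def T_def)
  have l1: "l \<le> 1" by (rule order_trans[OF l(3)]) (use k2 in simp)
  \<comment> \<open>In this form \<open>l * \<beta>\<close> is visibly the coefficient to be
    reached.\<close>
  have \<beta>: "\<beta> = 9 * L / (\<nu> * real k * (real k + 1) * l)"
    using False by (simp add: \<beta>_def ags_beta_def l_def ags_gamma_def mult_ac)
  then have \<beta>0: "\<beta> > 0" using pos l k2 by simp
  have \<gamma>: "0 \<le> ags_gamma k" "ags_gamma k \<le> 1" using k2 by (auto simp: ags_gamma_def)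
  have simps: "ags_alpha L M k t = a" "ags_p L M k t = p" "ags_q L M \<nu> k t = 0" for t
    using False by (auto simp: ags_alpha_def ags_p_def ags_q_def a_def p_def)
  have \<theta>: "\<theta> t > 0" "\<theta> (Suc t) * (1 - a) = \<theta> t" "\<theta> 0 = 1" for t
    using a by (auto simp: \<theta>_def)
  have \<theta>a: "\<theta> (Suc t) * a * p = \<theta> t" for t
    using \<theta>(2)[of t] a(3) by (simp add: mult.assoc mult.commute[of a])
  have \<theta>T: "\<theta> T * (1 - a) ^ T = 1" using a(2) by (simp add: \<theta>_def)
  have "1 < \<theta> T" using pow by (simp add: \<theta>_def)
  have \<gamma>_eq: "l * (\<theta> T - \<theta> 0) = ags_gamma k * \<theta> T"
  proof -
    have "ags_gamma k * \<theta> T = l * (\<theta> T - \<theta> T * (1 - a) ^ T)"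
      unfolding l(1)[symmetric] by (simp add: algebra_simps)
    then show ?thesis by (simp add: \<theta>T \<theta>(3))
  qed
  have l2: "l\<^sup>2 * (real k * (real k + 1)) \<le> 9"
  proof -
    have "l\<^sup>2 \<le> (3 / (real k + 1))\<^sup>2" using l by (intro power_mono) auto
    then have "l\<^sup>2 * (real k * (real k + 1)) \<le> (3 / (real k + 1))\<^sup>2 * ((real k + 1) * (real k + 1))"
      by (intro mult_mono) auto
    also have "\<dots> = 9" by (simp add: power2_eq_square)
    finally show ?thesis .
  qed
  have L\<gamma>: "L * ags_gamma k \<le> \<beta> * \<nu>"
  proof -
    \<comment> \<open>After cancelling \<open>L / (k + 1)\<close>, the condition on
      \<open>\<beta>\<close> is exactly this.\<close>
    have "2 * (real k * l) \<le> 9"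
    proof -
      have "real k * l \<le> real k * (3 / (real k + 1))" using l by (intro mult_left_mono) auto
      also have "\<dots> \<le> 3" by (simp add: field_simps)
      finally show ?thesis by simp
    qed
    then have "2 \<le> 9 / (real k * l)" using l k2 by (subst pos_le_divide_eq) auto
    then have "L / (real k + 1) * 2 \<le> L / (real k + 1) * (9 / (real k * l))"
      using pos by (intro mult_left_mono) auto
    then show ?thesis using pos by (simp add: \<beta> ags_gamma_def mult_ac)
  qed
  have cond: "M * l * a \<le> \<nu> * (\<beta> * p)"
  proof -
    \<comment> \<open>From \<open>M = L * p\<^sup>2\<close> and \<open>p * a = 1 - a\<close>; what
      remains follows from \<open>l2\<close>.\<close>
    have "M * l * a = L * p * l * (1 - a)"
      unfolding p(2)[symmetric] a(3) by (simp add: power2_eq_square)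
    also have "\<dots> \<le> L * p * l * 1" using a p pos l by (intro mult_left_mono) auto
    also have "\<dots> \<le> L * p * (9 / (real k * (real k + 1) * l))"
    proof -
      have "0 < real k * (real k + 1) * l" using l(2) k2 by simp
      moreover have "l * (real k * (real k + 1) * l) \<le> 9"
        using l2 by (simp add: power2_eq_square mult_ac)
      ultimately have "l \<le> 9 / (real k * (real k + 1) * l)" by (subst pos_le_divide_eq)
      then show ?thesis using p pos unfolding mult_1_right by (intro mult_left_mono) auto
    qed
    also have "\<dots> = \<nu> * (\<beta> * p)" using pos by (simp add: \<beta> mult_ac)
    finally show ?thesis .
  qed
  have "x' \<in> X \<and> xbar' \<in> X \<and> n = T \<and> (\<forall>u\<in>X. f xbar' + h xbar' - (f u + h u)
      \<le> (1 - ags_gamma k) * (f xbar + h xbar - (f u + h u))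
        + l * (\<beta> * \<theta> T) / \<theta> T * (V x u - V x' u))"
  proof (rule ags_step[where R = "\<lambda>t. \<beta> * \<theta> t", OF X _ _ \<beta>0 \<gamma> _ _ _ _ _ _ _ _ \<gamma>_eq L\<gamma> xl
        run[folded T_def l_def \<beta>_def] xbar'[folded l_def]])
    show "\<forall>t<T. \<theta> (Suc t) * ags_alpha L M k (Suc t) *
        (\<beta> * ags_p L M k (Suc t) + ags_q L M \<nu> k (Suc t)) = \<beta> * \<theta> t"
      using \<theta>a by (simp add: simps mult.left_commute[of _ \<beta>])
  qed (use a l l1 \<theta> \<open>1 < \<theta> T\<close> cond in \<open>auto simp: simps algebra_simps intro: less_imp_le\<close>)
  moreover have "l * (\<beta> * \<theta> T) / \<theta> T = 9 * L / (\<nu> * real k * (real k + 1))"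
    using \<theta>(1)[of T] l(2) by (simp add: \<beta>)
  ultimately show ?thesis by (simp add: T_def)
qed

section \<open>Convergence of a single AGS run\<close>

text \<open>The weights satisfy \<open>k (k + 1) / 2 * (1 - \<gamma>) = (k - 1) k / 2\<close> at
  step \<open>k\<close>, so the gaps telescope. The weight is 0 at the start, hence the initial gap
  does not enter the bound.\<close>

lemma ags_convergence:
  assumes x0: "x0 \<in> X"
    and run: "ags X f gf h gh V (ags_parameters L M \<nu>) x0 k = (x, xbar, nf, nh)"
  shows "x \<in> X \<and> xbar \<in> X \<and> nf = k \<and> nh = (\<Sum>i=1..k. ags_steps L M i) \<and>
    (\<forall>u\<in>X. real k * (real k + 1) / 2 * (f xbar + h xbar - (f u + h u))
        \<le> 9 * L / (2 * \<nu>) * (V x0 u - V x u))"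
  using run
proof (induction k arbitrary: x xbar nf nh)
  case 0
  with x0 show ?case by auto
next
  case (Suc k)
  let ?P = "ags_parameters L M \<nu>"
  obtain y ybar mf mh where run0: "ags X f gf h gh V ?P x0 k = (y, ybar, mf, mh)"
    by (metis prod_cases4)
  define j where "j = Suc k"
  define xl where "xl = (1 - ags_gamma j) *\<^sub>R ybar + ags_gamma j *\<^sub>R y"
  obtain x' xt n where pr: "prox_ag X h gh V (ags_alpha L M j) (ags_p L M j) (ags_q L M \<nu> j)
      (linearization f gf xl) ybar y (ags_lambda L M j) (ags_beta L M \<nu> j) (ags_steps L M j)
      = (x', xt, n)"
    by (metis prod_cases3)
  have eqs: "x = x'" "xbar = (1 - ags_lambda L M j) *\<^sub>R ybar + ags_lambda L M j *\<^sub>R xt"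
      "nf = Suc mf" "nh = mh + n"
    using Suc.prems pr unfolding j_def xl_def ags.simps run0
    by (simp_all add: Let_def ags_parameters_def)
  note IH = Suc.IH[OF run0]
  have "j \<ge> 1" by (simp add: j_def)
  note st = ags_parameters_step[OF this _ _ xl_def pr[folded eqs(1)] eqs(2)]
  have "real j * (real j + 1) / 2 * (f xbar + h xbar - (f u + h u))
        \<le> 9 * L / (2 * \<nu>) * (V x0 u - V x u)" if u: "u \<in> X" for u
  proof -
    let ?d = "f ybar + h ybar - (f u + h u)"
    have "f xbar + h xbar - (f u + h u)
        \<le> (1 - ags_gamma j) * ?d + 9 * L / (\<nu> * real j * (real j + 1)) * (V y u - V x u)"
      using st IH u by auto
    then have "real j * (real j + 1) / 2 * (f xbar + h xbar - (f u + h u))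
        \<le> real j * (real j + 1) / 2 *
          ((1 - ags_gamma j) * ?d + 9 * L / (\<nu> * real j * (real j + 1)) * (V y u - V x u))"
      by (intro mult_left_mono) auto
    also have "\<dots> = (real j * (real j + 1) / 2 * (1 - ags_gamma j)) * ?d
        + (real j * (real j + 1) / 2 * (9 * L / (\<nu> * real j * (real j + 1)))) * (V y u - V x u)"
      by (simp only: distrib_left mult.assoc)
    also have "real j * (real j + 1) / 2 * (1 - ags_gamma j) = real k * (real k + 1) / 2"
      by (simp add: j_def ags_gamma_def field_simps)
    also have "real j * (real j + 1) / 2 * (9 * L / (\<nu> * real j * (real j + 1))) = 9 * L / (2 * \<nu>)"
    proof -
      have "c / 2 * (9 * L / (\<nu> * c)) = 9 * L / (2 * \<nu>)" if "c \<noteq> 0" for c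
        using that by simp
      from this[of "real j * (real j + 1)"] show ?thesis by (simp add: j_def mult.assoc)
    qed
    also have "real k * (real k + 1) / 2 * ?d \<le> 9 * L / (2 * \<nu>) * (V x0 u - V y u)"
      using IH u by blast
    finally show ?thesis unfolding right_diff_distrib by simp
  qed
  with st IH eqs show ?case by (simp add: j_def)
qed


section \<open>Strong convexity and restarting\<close>

abbreviation "\<Phi> \<equiv> \<lambda>y. f y + h y"

text \<open>Strong convexity of \<open>f\<close> makes \<open>\<Phi>\<close> grow quadratically
  around any point, so the infimum is attained; at the minimizer the slope term is nonnegative and
  pure quadratic growth remains.\<close>

lemma optimal_point:
  assumes "v \<in> X"
  obtains m where "m \<in> X" "(INF y\<in>X. \<Phi> y) = \<Phi> m"
    and "\<And>y. y \<in> X \<Longrightarrow> \<Phi> m + \<mu> / 2 * (nrm (y - m))\<^sup>2 \<le> \<Phi> y"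
proof -
  define g where "g x = gf x + gh x" for x
  have grad: "gradient_on X \<Phi> g"
    using grad_f grad_h unfolding gradient_on_def g_def
    by (auto intro!: derivative_eq_intros simp: inner_add_left)
  have low: "\<Phi> x + g x \<bullet> (y - x) + \<mu> / 2 * (nrm (y - x))\<^sup>2 \<le> \<Phi> y"
    if "x \<in> X" "y \<in> X" for x y
    using f_lower[OF that(2,1)] h_lower[OF that(2,1)]
    by (simp add: linearization_def g_def inner_add_left)
  obtain m where m: "m \<in> X" "\<And>y. y \<in> X \<Longrightarrow> \<Phi> m \<le> \<Phi> y"
    using quadratic_growth_attains_min[OF norm_fun closed_X assms
        gradient_on_continuous_on[OF grad] _ low[OF assms]] pos by auto
  have "\<Phi> m + \<mu> / 2 * (nrm (y - m))\<^sup>2 \<le> \<Phi> y" if "y \<in> X" for y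
    using low[OF m(1) that] first_order_optimality[OF grad convex_X m(1) that m(2)] by simp
  moreover have "(INF y\<in>X. \<Phi> y) = \<Phi> m"
    using m by (intro cInf_eq_minimum) auto
  ultimately show ?thesis using that m(1) by blast
qed

text \<open>Quadratic growth of \<open>V\<close> and of \<open>\<Phi>\<close> around the minimizer
  bound \<open>V v m\<close> by the current gap divided by \<open>\<mu>\<close>. The constant 18 is
  what turns the resulting factor into 1/2.\<close>

lemma ags_halves_gap:
  assumes v: "v \<in> X" and N: "18 * L / (\<nu> * \<mu>) \<le> (real N)\<^sup>2"
    and run: "ags X f gf h gh V (ags_parameters L M \<nu>) v N = (x, xbar, nf, nh)"
  shows "\<Phi> xbar - (INF y\<in>X. \<Phi> y) \<le> (\<Phi> v - (INF y\<in>X. \<Phi> y)) / 2"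
proof -
  obtain m where m: "m \<in> X" "(INF y\<in>X. \<Phi> y) = \<Phi> m"
    "\<And>y. y \<in> X \<Longrightarrow> \<Phi> m + \<mu> / 2 * (nrm (y - m))\<^sup>2 \<le> \<Phi> y"
    using optimal_point[OF v] by blast
  define \<delta> where "\<delta> = \<Phi> xbar - \<Phi> m"
  define E where "E = (nrm (v - m))\<^sup>2"
  have E: "E \<ge> 0" "\<mu> * E \<le> 2 * (\<Phi> v - \<Phi> m)" using m(3)[OF v] by (auto simp: E_def)
  have conv: "x \<in> X" "xbar \<in> X"
    "real N * (real N + 1) / 2 * \<delta> \<le> 9 * L / (2 * \<nu>) * (V v m - V x m)"
    using ags_convergence[OF v run] m(1) by (auto simp: \<delta>_def)
  have \<delta>0: "0 \<le> \<delta>"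
  proof -
    have "0 \<le> \<mu> / 2 * (nrm (xbar - m))\<^sup>2" using pos by simp
    with m(3)[OF conv(2)] show ?thesis by (simp add: \<delta>_def)
  qed
  have "9 * L / \<nu> * \<delta> = 18 * L / (\<nu> * \<mu>) / 2 * (\<mu> * \<delta>)" using pos by simp
  also have "\<dots> \<le> (real N)\<^sup>2 / 2 * (\<mu> * \<delta>)"
    using N \<delta>0 pos by (intro mult_right_mono divide_right_mono) auto
  also have "\<dots> \<le> \<mu> * (real N * (real N + 1) / 2 * \<delta>)"
  proof -
    have "0 \<le> \<mu> * (real N / 2 * \<delta>)" using pos \<delta>0 by simp
    then show ?thesis by (simp add: power2_eq_square algebra_simps)
  qed
  also have "\<dots> \<le> \<mu> * (9 * L / (2 * \<nu>) * (V v m - V x m))"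
    using conv(3) pos by (intro mult_left_mono) auto
  also have "\<dots> \<le> \<mu> * (9 * L / (2 * \<nu>) * (1 / 2 * E))"
    using V_upper[OF v m(1)] V_nonneg[OF conv(1) m(1)] pos
    by (intro mult_left_mono) (auto simp: E_def)
  also have "\<dots> = 9 * L / (4 * \<nu>) * (\<mu> * E)" by simp
  also have "\<dots> \<le> 9 * L / (4 * \<nu>) * (2 * (\<Phi> v - \<Phi> m))"
    using E(2) pos by (intro mult_left_mono) auto
  also have "\<dots> = 9 * L / \<nu> * ((\<Phi> v - \<Phi> m) / 2)"
  proof -
    have "9 * L / (4 * \<nu>) * (2 * y) = 9 * L / \<nu> * (y / 2)" for y by simp
    then show ?thesis .
  qed
  finally have "9 * L / \<nu> * \<delta> \<le> 9 * L / \<nu> * ((\<Phi> v - \<Phi> m) / 2)" .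
  then have "\<delta> \<le> (\<Phi> v - \<Phi> m) / 2"
    using pos by (subst (asm) mult_le_cancel_left_pos) auto
  then show ?thesis by (simp add: m(2) \<delta>_def)
qed

text \<open>The condition on \<open>N\<close> does not involve the starting point, so the halving
  can be repeated at every restart.\<close>

lemma mags_convergence:
  assumes v0: "v0 \<in> X" and N: "18 * L / (\<nu> * \<mu>) \<le> (real N)\<^sup>2"
    and run: "mags X f gf h gh V (ags_parameters L M \<nu>) v0 N s = (v, nf, nh)"
  shows "v \<in> X \<and> nf = N * s \<and> nh = (\<Sum>i=1..N. ags_steps L M i) * s \<and>
    \<Phi> v - (INF y\<in>X. \<Phi> y) \<le> (\<Phi> v0 - (INF y\<in>X. \<Phi> y)) / 2 ^ s"
  using run
proof (induction s arbitrary: v nf nh)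
  case 0
  with v0 show ?case by auto
next
  case (Suc s)
  obtain w mf mh where run0: "mags X f gf h gh V (ags_parameters L M \<nu>) v0 N s = (w, mf, mh)"
    by (metis prod_cases3)
  obtain x xbar kf kh where run1: "ags X f gf h gh V (ags_parameters L M \<nu>) w N = (x, xbar, kf, kh)"
    by (metis prod_cases4)
  have eqs: "v = xbar" "nf = mf + kf" "nh = mh + kh"
    using Suc.prems by (auto simp: run0 run1)
  note IH = Suc.IH[OF run0]
  then have "w \<in> X" by simp
  with ags_halves_gap[OF this N run1] ags_convergence[OF this run1] IH
  show ?case by (auto simp: eqs algebra_simps)
qed

section \<open>Gradient counts and the final bound\<close>

text \<open>For \<open>k \<noteq> 1\<close>, \<open>- ln (1 - a) \<ge> a\<close> gives
  \<open>ln 3 * (p + 1)\<close>, and rounding adds 1. For \<open>k = 1\<close> the count is at most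
  \<open>2 * p + 1\<close>, which fits because \<open>ln 3 \<ge> 1\<close>.\<close>

lemma ags_steps_le: "real (ags_steps L M k) \<le> (1 + ln 3) * (sqrt (M / L) + 1)"
proof (cases "k = 1")
  case True
  define p where "p = sqrt (M / L)"
  have p: "1 \<le> p" using sqrt_ratio_ge_1 by (simp add: p_def)
  have "sqrt (8 * M / (7 * L)) \<le> sqrt (4 * (M / L))"
    using pos by (intro real_sqrt_le_mono) (simp add: field_simps)
  also have "\<dots> = 2 * p" unfolding p_def real_sqrt_mult by simp
  finally have "real (ags_steps L M k) \<le> 2 * p + 1"
    using True pos by (simp add: ags_steps_def) linarith
  moreover have "ln (3::real) \<ge> 1" using exp_le by (simp add: ln_ge_iff)
  then have "2 * (p + 1) \<le> (1 + ln 3) * (p + 1)" using p by (intro mult_right_mono) auto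
  ultimately show ?thesis by (simp add: p_def)
next
  case False
  define p where "p = sqrt (M / L)"
  define a where "a = 1 / (p + 1)"
  have p: "1 \<le> p" using sqrt_ratio_ge_1 by (simp add: p_def)
  have a: "0 < a" "a < 1" using momentum_bounds by (auto simp: a_def p_def)
  have "ln (1 - a) \<le> - a" using ln_le_minus_one[of "1 - a"] a by simp
  then have al: "a \<le> - ln (1 - a)" by simp
  have "ln 3 / (- ln (1 - a)) \<le> ln 3 / a"
    using al a by (intro divide_left_mono mult_pos_pos) auto
  also have "\<dots> = ln 3 * (p + 1)" using p by (simp add: a_def)
  finally have *: "ln 3 / (- ln (1 - a)) \<le> ln 3 * (p + 1)" .
  have "0 \<le> ln 3 / (- ln (1 - a))" using al a by (intro divide_nonneg_nonneg) auto
  then have "real (ags_steps L M k) \<le> ln 3 / (- ln (1 - a)) + 1"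
    using False unfolding ags_steps_def a_def p_def by simp linarith
  with * p show ?thesis by (simp add: p_def[symmetric] algebra_simps)
qed

lemma sum_ags_steps_le:
  "real (\<Sum>i=1..N. ags_steps L M i) \<le> (1 + ln 3) * real N * (sqrt (M / L) + 1)"
proof -
  have "real (\<Sum>i=1..N. ags_steps L M i) \<le> (\<Sum>i=1..N. (1 + ln 3) * (sqrt (M / L) + 1))"
    unfolding of_nat_sum by (intro sum_mono ags_steps_le)
  then show ?thesis by (simp add: algebra_simps)
qed

end

text \<open>Here \<open>K\<close> stands for \<open>\<nu> * \<mu>\<close>. Factoring out
  \<open>sqrt (L / K)\<close> reduces the claim to \<open>(1 + ln 3) * sqrt 2 < 3\<close>.\<close>

lemma complexity_constant:
  fixes L M K :: real
  assumes "L > 0" "M > 0" "K > 0"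
  shows "(1 + ln 3) * (3 * sqrt (2 * L / K)) * (sqrt (M / L) + 1)
    < 9 * (sqrt (L / K) + sqrt (M / K))"
proof -
  define S where "S = sqrt (L / K) + sqrt (M / K)"
  have S: "S > 0" using assms by (simp add: S_def add_pos_pos)
  have "sqrt (L / K) * sqrt (M / L) = sqrt (M / K)"
    using assms by (simp flip: real_sqrt_mult)
  then have "sqrt (L / K) * (sqrt (M / L) + 1) = S" by (simp add: S_def algebra_simps)
  moreover have "sqrt (2 * L / K) = sqrt 2 * sqrt (L / K)" by (simp flip: real_sqrt_mult)
  ultimately have "(1 + ln 3) * (3 * sqrt (2 * L / K)) * (sqrt (M / L) + 1)
      = ((1 + ln 3) * sqrt 2) * (3 * S)" by (simp add: mult.assoc mult.left_commute)
  also have "\<dots> < 3 * (3 * S)"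
    using S ln_3_bound by (intro mult_strict_right_mono) (auto simp: pos_less_divide_eq)
  finally show ?thesis by (simp add: S_def)
qed

text \<open>Iteration numbers are integers, so \<open>N0\<close> and \<open>S\<close> are rounded up
  and the counts are bounded through \<open>N0 * S\<close>; when both prescribed values are integers
  this product is \<open>N_f\<close>. If \<open>\<Delta>0 \<le> \<epsilon>\<close> the logarithm is
  0 and both sides of the last bound vanish, so strictness is asserted for
  \<open>\<epsilon> < \<Delta>0\<close>.\<close>

theorem theorem2:
  fixes X :: "(real ^ 'n) set"
    and nrm :: "real ^ 'n \<Rightarrow> real"
    and f h \<phi> :: "real ^ 'n \<Rightarrow> real"
    and gf gh :: "real ^ 'n \<Rightarrow> real ^ 'n"
    and V :: "real ^ 'n \<Rightarrow> real ^ 'n \<Rightarrow> real"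
    and L M \<mu> \<nu> \<epsilon> \<Delta>0 N_f N_h :: real
    and v0 v :: "real ^ 'n"
    and N0 S nf nh :: nat
  assumes "norm_fun nrm"
    and "closed X" and "convex X"
    and "convex_on X f" and "gradient_on X f gf" and "continuous_on X gf"
    and "convex_on X h" and "gradient_on X h gh" and "continuous_on X gh"
    and "L > 0" and "M > 0" and "\<mu> > 0"
    and "\<And>x u. x \<in> X \<Longrightarrow> u \<in> X \<Longrightarrow> \<mu> / 2 * (nrm (x - u))\<^sup>2 \<le> f x - linearization f gf u x"
    and "\<And>x u. x \<in> X \<Longrightarrow> u \<in> X \<Longrightarrow> f x - linearization f gf u x \<le> L / 2 * (nrm (x - u))\<^sup>2"
    and "\<And>x u. x \<in> X \<Longrightarrow> u \<in> X \<Longrightarrow> 0 \<le> h x - linearization h gh u x"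
    and "\<And>x u. x \<in> X \<Longrightarrow> u \<in> X \<Longrightarrow> h x - linearization h gh u x \<le> M / 2 * (nrm (x - u))\<^sup>2"
    and "\<And>x. \<phi> x = f x + h x"
    and "M \<ge> L"
    and "\<nu> > 0" and "prox_function nrm X \<nu> V"
    and "\<And>x u. x \<in> X \<Longrightarrow> u \<in> X \<Longrightarrow> V x u \<le> 1 / 2 * (nrm (x - u))\<^sup>2"
    and "v0 \<in> X" and "\<epsilon> > 0"
    and "\<phi> v0 - (INF y\<in>X. \<phi> y) \<le> \<Delta>0"
    and "N0 = nat \<lceil>3 * sqrt (2 * L / (\<nu> * \<mu>))\<rceil>"
    and "S = nat \<lceil>log 2 (max (\<Delta>0 / \<epsilon>) 1)\<rceil>"
    and "(v, nf, nh) = mags X f gf h gh V (ags_parameters L M \<nu>) v0 N0 S"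
    and "N_f = 3 * sqrt (2 * L / (\<nu> * \<mu>)) * log 2 (max (\<Delta>0 / \<epsilon>) 1)"
    and "N_h = (1 + ln 3) * N_f * (sqrt (M / L) + 1)"
  shows "eps_solution \<phi> X \<epsilon> v
    \<and> real nf \<le> real N0 * real S
    \<and> real nh \<le> (1 + ln 3) * (real N0 * real S) * (sqrt (M / L) + 1)
    \<and> (3 * sqrt (2 * L / (\<nu> * \<mu>)) \<in> \<int> \<and> log 2 (max (\<Delta>0 / \<epsilon>) 1) \<in> \<int>
         \<longrightarrow> real nf \<le> N_f \<and> real nh \<le> N_h)
    \<and> N_h \<le> 9 * (sqrt (L / (\<nu> * \<mu>)) + sqrt (M / (\<nu> * \<mu>))) * log 2 (max (\<Delta>0 / \<epsilon>) 1)
    \<and> (\<epsilon> < \<Delta>0 \<longrightarrow>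
         N_h < 9 * (sqrt (L / (\<nu> * \<mu>)) + sqrt (M / (\<nu> * \<mu>))) * log 2 (max (\<Delta>0 / \<epsilon>) 1))"
proof -
  obtain \<pi> g\<pi> where \<pi>: "strongly_convex_on nrm X \<nu> \<pi>" "gradient_on X \<pi> g\<pi>"
    "\<And>x u. x \<in> X \<Longrightarrow> u \<in> X \<Longrightarrow> V x u = \<pi> u - \<pi> x - g\<pi> x \<bullet> (u - x)"
    using assms(20) unfolding prox_function_def by blast
  interpret composite_prox X nrm f h gf gh V L M \<mu> \<nu> \<pi> g\<pi>
    by unfold_locales (use assms \<pi> in auto)
  define \<rho> where "\<rho> = 3 * sqrt (2 * L / (\<nu> * \<mu>))"
  define \<sigma> where "\<sigma> = log 2 (max (\<Delta>0 / \<epsilon>) 1)"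
  have \<phi>: "\<phi> = \<Phi>" using assms(17) by auto
  have \<rho>0: "\<rho> > 0" using pos by (simp add: \<rho>_def)
  have \<sigma>0: "\<sigma> \<ge> 0" by (simp add: \<sigma>_def)
  have \<rho>: "\<rho> \<le> real N0" unfolding assms(25) \<rho>_def by (rule real_nat_ceiling_ge)
  have \<sigma>: "\<sigma> \<le> real S" unfolding assms(26) \<sigma>_def by (rule real_nat_ceiling_ge)
  have "18 * L / (\<nu> * \<mu>) = \<rho>\<^sup>2" using pos by (simp add: \<rho>_def power_mult_distrib)
  also have "\<dots> \<le> (real N0)\<^sup>2" using \<rho> \<rho>0 by (intro power_mono) auto
  finally have conv: "v \<in> X" "nf = N0 * S" "nh = (\<Sum>i=1..N0. ags_steps L M i) * S"
    "\<Phi> v - (INF y\<in>X. \<Phi> y) \<le> (\<Phi> v0 - (INF y\<in>X. \<Phi> y)) / 2 ^ S"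
    using mags_convergence[OF assms(22) _ assms(27)[symmetric]] by auto
  have eps: "eps_solution \<phi> X \<epsilon> v"
  proof -
    \<comment> \<open>After \<open>S\<close> halvings the initial estimate has been divided by at
      least \<open>\<Delta>0 / \<epsilon>\<close>.\<close>
    have "\<Delta>0 / \<epsilon> \<le> max (\<Delta>0 / \<epsilon>) 1" by simp
    also have "\<dots> = 2 powr \<sigma>" by (simp add: \<sigma>_def)
    also have "\<dots> \<le> 2 powr real S" using \<sigma> by (intro powr_mono) auto
    finally have "\<Delta>0 / 2 ^ S \<le> \<epsilon>" using assms(23) by (simp add: powr_realpow field_simps)
    moreover have "(\<Phi> v0 - (INF y\<in>X. \<Phi> y)) / 2 ^ S \<le> \<Delta>0 / 2 ^ S"
      using assms(24) by (intro divide_right_mono) (auto simp: \<phi>)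
    ultimately show ?thesis using conv by (simp add: eps_solution_def \<phi>)
  qed
  have nh: "real nh \<le> (1 + ln 3) * (real N0 * real S) * (sqrt (M / L) + 1)"
    using mult_right_mono[OF sum_ags_steps_le[of N0], of "real S"] by (simp add: conv(3) algebra_simps)
  have Nf: "N_f = \<rho> * \<sigma>" using assms(28) by (simp add: \<rho>_def \<sigma>_def)
  have int: "real N0 * real S = N_f" if "\<rho> \<in> \<int>" "\<sigma> \<in> \<int>"
    using that \<rho>0 \<sigma>0 unfolding Nf assms(25,26) \<rho>_def[symmetric] \<sigma>_def[symmetric]
    by (auto elim!: Ints_cases)
  have Nh: "N_h = (1 + ln 3) * \<rho> * (sqrt (M / L) + 1) * \<sigma>"
    using assms(29) Nf by (simp add: algebra_simps)
  have const: "(1 + ln 3) * \<rho> * (sqrt (M / L) + 1)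
      < 9 * (sqrt (L / (\<nu> * \<mu>)) + sqrt (M / (\<nu> * \<mu>)))"
    unfolding \<rho>_def using pos by (intro complexity_constant) auto
  have "N_h \<le> 9 * (sqrt (L / (\<nu> * \<mu>)) + sqrt (M / (\<nu> * \<mu>))) * \<sigma>"
    unfolding Nh using const \<sigma>0 by (intro mult_right_mono) auto
  moreover have "N_h < 9 * (sqrt (L / (\<nu> * \<mu>)) + sqrt (M / (\<nu> * \<mu>))) * \<sigma>" if "\<epsilon> < \<Delta>0"
  proof -
    have "\<sigma> > 0" using that assms(23) by (simp add: \<sigma>_def less_max_iff_disj)
    then show ?thesis unfolding Nh using const by (intro mult_strict_right_mono) auto
  qed
  moreover have "real nf \<le> N_f \<and> real nh \<le> N_h" if "\<rho> \<in> \<int>" "\<sigma> \<in> \<int>"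
    using int[OF that] nh assms(29) by (simp add: conv(2))
  ultimately show ?thesis
    unfolding \<rho>_def[symmetric] \<sigma>_def[symmetric] using eps nh conv(2) by simp
qed

end
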